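(* Suppose there exists an MPC algorithm $\mathcal{A}$ that, for every $\varepsilon$, computes a $(1+\varepsilon)$-approximate maximum weight matching in any graph with $n$ vertices, $m$ edges and maximum edge weight ratio $W$ in $R(n,m,W,\varepsilon)$ rounds, with $S(n,m,W,\varepsilon)$ space per machine and $T(n,m,W,\varepsilon)$ total space. Then there exists an MPC algorithm $\mathcal{A}'$ that computes a $(1+16\varepsilon)$-approximate maximum weight matching in $O\!\left(R(n,m,f(\varepsilon),\varepsilon)\right)$ rounds, with $O\!\left(S(n,m,f(\varepsilon),\varepsilon)+n\cdot\log_{1/\varepsilon} W\right)$ space per machine and $O\!\left(\frac{T(n,m,f(\varepsilon),\varepsilon)\cdot\log_{1/\varepsilon} W}{\varepsilon}\right)$ total space, where $f(\varepsilon)$ is some function of $\varepsilon$ only.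
   Context: The maximum edge weight ratio $W$ of a weighted graph is the ratio of its maximum to its minimum edge weight. A $(1+\varepsilon)$-approximate maximum weight matching is a matching $M$ with $(1+\varepsilon)\,w(M)\ge w(\mathcal{M})$, where $w$ denotes total edge weight and $\mathcal{M}$ a maximum weight matching. MPC model: machines with bounded local space, input edges partitioned arbitrarily among machines, communicating in synchronous rounds; measures are rounds, space per machine and total space. Here $\varepsilon\in(0,1/2)$.
   Formalization: The logarithm log_{1/ε} W is replaced by log_{1/ε} max(2,W), since for W=1 the stated total space bound is 0, below the input size; m and W are read as upper bounds on the number of edges and the weight ratio. *)

theory Defs
  imports Complex_Main
begin

type_synonym edge = "nat set"

definition simple_graph :: "nat \<Rightarrow> edge set \<Rightarrow> bool" where
  "simple_graph n E \<longleftrightarrow> E \<subseteq> {{u, v} | u v. u < n \<and> v < n \<and> u \<noteq> v}"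

definition is_matching :: "edge set \<Rightarrow> edge set \<Rightarrow> bool" where
  "is_matching E M \<longleftrightarrow> M \<subseteq> E \<and> pairwise disjnt M"

definition is_max_weight_matching :: "edge set \<Rightarrow> (edge \<Rightarrow> real) \<Rightarrow> edge set \<Rightarrow> bool" where
  "is_max_weight_matching E w M \<longleftrightarrow>
     is_matching E M \<and> (\<forall>M'. is_matching E M' \<longrightarrow> sum w M' \<le> sum w M)"

definition approx_max_weight_matching ::
  "real \<Rightarrow> edge set \<Rightarrow> (edge \<Rightarrow> real) \<Rightarrow> edge set \<Rightarrow> bool" where
  "approx_max_weight_matching \<alpha> E w M \<longleftrightarrow>
     is_matching E M \<and> (\<exists>Mopt. is_max_weight_matching E w Mopt \<and> \<alpha> * sum w M \<ge> sum w Mopt)"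

definition weight_ratio :: "edge set \<Rightarrow> (edge \<Rightarrow> real) \<Rightarrow> real" where
  "weight_ratio E w = Max (w ` E) / Min (w ` E)"

text \<open>
  The MPC model. Space is counted in machine words; a word is a number below the word
  modulus \<open>B\<close> (the word length is \<open>log B\<close> bits), and \<open>B \<ge> n\<close> so that a vertex fits in a word.
  An edge weight also occupies one word, its code \<open>c e\<close>; the real number denoted by a code is
  given by the number format \<open>dec\<close> (\<open>dec = real\<close> for integer weights). An edge takes three words.
\<close>

definition encode :: "(edge \<Rightarrow> nat) \<Rightarrow> edge list \<Rightarrow> nat list" where
  "encode c es = concat (map (\<lambda>e. [Min e, Max e, c e]) es)"

text \<open>
  \<open>send N t i x j\<close> is what machine \<open>i\<close>, having memory \<open>x\<close> at the beginning of round \<open>t\<close>, sends to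
  machine \<open>j\<close>. Local computation is unrestricted. What a machine keeps for the next round
  is its message to itself, so its memory after a round is the concatenation of all it received.
\<close>

record network =
  machines :: nat
  send :: "nat \<Rightarrow> nat \<Rightarrow> nat list \<Rightarrow> nat \<Rightarrow> nat list"

fun memory :: "network \<Rightarrow> (nat \<Rightarrow> nat list) \<Rightarrow> nat \<Rightarrow> nat \<Rightarrow> nat list" where
  "memory N x 0 j = x j"
| "memory N x (Suc t) j = concat (map (\<lambda>i. send N t i (memory N x t i) j) [0..<machines N])"

definition space_bounded ::
  "nat \<Rightarrow> network \<Rightarrow> (nat \<Rightarrow> nat list) \<Rightarrow> nat \<Rightarrow> nat \<Rightarrow> nat \<Rightarrow> bool" where
  "space_bounded B N x R S T \<longleftrightarrow>
     (\<forall>t\<le>R. \<forall>i<machines N. length (memory N x t i) \<le> S \<and> set (memory N x t i) \<subseteq> {..<B}) \<and>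
     (\<forall>t\<le>R. (\<Sum>i<machines N. length (memory N x t i)) \<le> T) \<and>
     (\<forall>t<R. \<forall>i<machines N.
        (\<Sum>j\<in>{..<machines N} - {i}. length (send N t i (memory N x t i) j)) \<le> S)"

text \<open>A distribution of a finite set of edges among the machines \<open>0, \<dots>, p - 1\<close>.\<close>

definition distributed :: "nat \<Rightarrow> (nat \<Rightarrow> edge list) \<Rightarrow> edge set \<Rightarrow> bool" where
  "distributed p D E \<longleftrightarrow>
     distinct (concat (map D [0..<p])) \<and> set (concat (map D [0..<p])) = E"

definition initial_memory :: "nat \<Rightarrow> (edge \<Rightarrow> nat) \<Rightarrow> (nat \<Rightarrow> edge list) \<Rightarrow> nat \<Rightarrow> nat list" where
  "initial_memory p c D i = (if i < p then encode c (D i) else [])"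

text \<open>
  The parameters known to all machines are, in this order: \<open>n\<close>, \<open>m\<close>, \<open>W\<close>, \<open>\<epsilon>\<close>, the word modulus
  \<open>B\<close>, and the number \<open>p\<close> of machines among which the input is partitioned.
\<close>

type_synonym mpc_algorithm = "nat \<Rightarrow> nat \<Rightarrow> real \<Rightarrow> real \<Rightarrow> nat \<Rightarrow> nat \<Rightarrow> network"

type_synonym resource = "nat \<Rightarrow> nat \<Rightarrow> real \<Rightarrow> real \<Rightarrow> nat"

definition valid_params :: "real \<Rightarrow> real \<Rightarrow> bool" where
  "valid_params W \<epsilon> \<longleftrightarrow> 1 \<le> W \<and> 0 < \<epsilon> \<and> \<epsilon> < 1 / 2"

text \<open>
  Weighted graphs with \<open>n\<close> vertices, at most \<open>m\<close> edges and weight ratio at most \<open>W\<close>.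
\<close>

definition instance_graph ::
  "(nat \<Rightarrow> real) \<Rightarrow> nat \<Rightarrow> nat \<Rightarrow> real \<Rightarrow> nat \<Rightarrow> edge set \<Rightarrow> (edge \<Rightarrow> nat) \<Rightarrow> bool" where
  "instance_graph dec n m W B E c \<longleftrightarrow>
     simple_graph n E \<and> card E \<le> m \<and> (\<forall>e\<in>E. c e < B \<and> 0 < dec (c e)) \<and>
     (E \<noteq> {} \<longrightarrow> weight_ratio E (dec \<circ> c) \<le> W)"

text \<open>
  The first conjunct keeps the number of machines polynomial: machines know their own index, which
  is not charged as space and therefore must not carry more than logarithmically many bits.
  In the second one, \<open>3 \<le> S\<close> says that a machine can hold an edge; without it a space bound
  could be met vacuously because no partition of the input fits into the machines.
  In the end the memories hold the matching, each of its edges being stored exactly once.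
\<close>

definition mpc_mwm_algorithm ::
  "(nat \<Rightarrow> real) \<Rightarrow> (real \<Rightarrow> real) \<Rightarrow> mpc_algorithm \<Rightarrow> resource \<Rightarrow> resource \<Rightarrow> resource \<Rightarrow> bool" where
  "mpc_mwm_algorithm dec \<alpha> A R S T \<longleftrightarrow>
     (\<exists>k. \<forall>n m W \<epsilon> B p. valid_params W \<epsilon> \<longrightarrow> n \<le> B \<longrightarrow>
        p \<le> machines (A n m W \<epsilon> B p) \<and>
        machines (A n m W \<epsilon> B p) \<le> (2 + n + p + T n m W \<epsilon>) ^ k) \<and>
     (\<forall>n m W \<epsilon> B E c. valid_params W \<epsilon> \<longrightarrow> n \<le> B \<longrightarrow> instance_graph dec n m W B E c \<longrightarrow>
        (E \<noteq> {} \<longrightarrow> 3 \<le> S n m W \<epsilon>) \<and>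
        (\<forall>p D. distributed p D E \<longrightarrow> (\<forall>i<p. length (encode c (D i)) \<le> S n m W \<epsilon>) \<longrightarrow>
           (let N = A n m W \<epsilon> B p; x = initial_memory p c D; r = R n m W \<epsilon> in
              space_bounded B N x r (S n m W \<epsilon>) (T n m W \<epsilon>) \<and>
              (\<exists>D' M. distributed (machines N) D' M \<and>
                 (\<forall>i<machines N. memory N x r i = encode c (D' i)) \<and>
                 approx_max_weight_matching (\<alpha> \<epsilon>) E (dec \<circ> c) M))))"

end

theory Submission
  imports Defs
begin

text \<open>
  Round weights to classes \<open>a = floor (log (1/\<epsilon>) w)\<close> and let \<open>K = ceil (1/\<epsilon>)\<close>. For each shift \<open>s < K\<close>,
  dropping the classes congruent to \<open>s\<close> modulo \<open>K\<close> cuts the graph into levels of weight ratio at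
  most \<open>(1/\<epsilon>)^K\<close> that are separated by a factor \<open>1/\<epsilon>\<close>. The given algorithm runs in parallel on all
  levels for all shifts, and one machine computes a maximum weight matching in the union of
  the results. For the shift that drops at most the fraction \<open>1/K\<close> of an optimal matching, picking
  edges greedily from the heaviest level downwards loses only another factor \<open>1 + 4\<epsilon>\<close>.

  If \<open>W \<le> (1/\<epsilon>)^K\<close> the given algorithm is used directly. Otherwise \<open>log (1/\<epsilon>) W > K\<close>, so there are
  only \<open>O(log (1/\<epsilon>) W)\<close> pairs of a shift and a level, all resulting matchings fit into one machine,
  and a machine holding a single edge can send it to all of them in one round.
\<close>

section \<open>Matchings in layered graphs\<close>

text \<open>The resource functions of the given algorithm are arbitrary, so every inequality that
  the reduction needs about them has to be extracted from the algorithm itself. For this it is run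
  on the same edges with all weights made equal, an instance for every ratio bound. The outcome is
  room for one edge per machine, total space for the whole input, and at least one round unless the
  input is already a matching; only then do additional rounds disappear in a constant factor. No
  machine sees the whole graph. An edge must therefore find its groups from its own weight code, and
  the good shift, which depends on an unknown optimum, cannot be singled out. Optimality in the
  union of all results replaces that choice. The losses are a factor 1 - \<epsilon> for dropped
  classes, 1 + \<epsilon> for the given algorithm and 1 + 4\<epsilon> for combining levels; 16 is
  the least coefficient that absorbs them for all \<epsilon> < 1/2.\<close>

lemma simple_graph_edgeE:
  assumes "simple_graph n E" "e \<in> E"
  obtains u v where "e = {u, v}" "u < v" "v < n"
proof -
  obtain u v where "e = {u, v}" "u < n" "v < n" "u \<noteq> v"
    using assms unfolding simple_graph_def by blast
  then show ?thesis
    using that[of u v] that[of v u] by (metis insert_commute linorder_neqE_nat)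
qed

lemma simple_graph_card2: "simple_graph n E \<Longrightarrow> e \<in> E \<Longrightarrow> card e = 2"
  by (erule (1) simple_graph_edgeE) simp

lemma simple_graph_subset: "simple_graph n E \<Longrightarrow> E' \<subseteq> E \<Longrightarrow> simple_graph n E'"
  unfolding simple_graph_def by blast

lemma simple_graph_finite:
  assumes "simple_graph n E" shows "finite E"
proof (rule finite_subset)
  show "E \<subseteq> Pow {..<n}" using assms unfolding simple_graph_def by auto
qed simp

text \<open>Disjoint edges have distinct smaller endpoints. This limits what each group contributes
  to the machine that gathers all results.\<close>

lemma matching_card_le:
  assumes "simple_graph n E" "is_matching E M"
  shows "card M \<le> n"
proof -
  have M: "M \<subseteq> E" "pairwise disjnt M"
    using assms(2) by (auto simp: is_matching_def)
  have mem: "Min e \<in> e \<and> Min e < n" if e: "e \<in> M" for e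
  proof -
    obtain u v where "e = {u, v}" "u < v" "v < n"
      using simple_graph_edgeE[OF assms(1)] M(1) e by blast
    then show ?thesis by (auto simp: min_def)
  qed
  have "inj_on Min M"
    by (rule inj_onI) (metis M(2) mem disjnt_iff pairwiseD)
  then have "card M = card (Min ` M)" by (simp add: card_image)
  also have "\<dots> \<le> card {..<n}" using mem by (intro card_mono) auto
  finally show ?thesis by simp
qed

lemma max_weight_matching_exists:
  assumes "finite E"
  shows "\<exists>M. is_max_weight_matching E w M"
proof -
  have fin: "finite {M. is_matching E M}"
    by (rule finite_subset[of _ "Pow E"]) (auto simp: is_matching_def assms)
  moreover have "{} \<in> {M. is_matching E M}" by (simp add: is_matching_def)
  ultimately have "Max (sum w ` {M. is_matching E M}) \<in> sum w ` {M. is_matching E M}"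
    by (intro Max_in) auto
  then obtain M where "is_matching E M" "sum w M = Max (sum w ` {M. is_matching E M})"
    by auto
  then show ?thesis unfolding is_max_weight_matching_def using fin by auto
qed

text \<open>Since an optimum exists, the guarantee can be applied to any competitor, in particular
  to the part of a given matching that falls into one group.\<close>

lemma approx_max_weight_matching_iff:
  assumes "finite E"
  shows "approx_max_weight_matching \<alpha> E w M \<longleftrightarrow>
    is_matching E M \<and> (\<forall>M'. is_matching E M' \<longrightarrow> sum w M' \<le> \<alpha> * sum w M)"
  using max_weight_matching_exists[OF assms, of w]
  unfolding approx_max_weight_matching_def is_max_weight_matching_def
  by (meson order_trans)

text \<open>Distinct exponents are dominated by the full series \<epsilon> / (1 - \<epsilon>), and
  \<epsilon> \<le> 1/2 bounds the denominator. The exponents will be the level differences of the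
  edges discarded at one endpoint.\<close>

lemma geometric_sum_inj_le:
  fixes \<epsilon> :: real and d :: "'a \<Rightarrow> nat"
  assumes "0 < \<epsilon>" "\<epsilon> \<le> 1/2" "finite F" "inj_on d F" "\<And>x. x \<in> F \<Longrightarrow> 1 \<le> d x"
  shows "(\<Sum>x\<in>F. \<epsilon> ^ d x) \<le> 2 * \<epsilon>"
proof -
  define N where "N = Max (insert 1 (d ` F))"
  have "(\<Sum>x\<in>F. \<epsilon> ^ d x) = (\<Sum>i\<in>d ` F. \<epsilon> ^ i)"
    by (simp add: sum.reindex[OF assms(4)])
  also have "\<dots> \<le> (\<Sum>i\<in>{1..<Suc N}. \<epsilon> ^ i)"
    using assms by (intro sum_mono2) (auto simp: N_def less_Suc_eq_le)
  also have "\<dots> = (\<Sum>i<N. \<epsilon> ^ Suc i)"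
    by (simp only: One_nat_def sum.shift_bounds_Suc_ivl atLeast0LessThan)
  also have "\<dots> = \<epsilon> * ((1 - \<epsilon> ^ N) / (1 - \<epsilon>))"
    using assms by (simp add: sum_distrib_left[symmetric] sum_gp_strict)
  also have "\<dots> \<le> \<epsilon> * 2"
    using assms by (intro mult_left_mono) (auto simp: field_simps add_increasing2)
  finally show ?thesis by simp
qed

text \<open>Keep an edge of maximal level, discard its neighbours, and repeat: at either endpoint the
  discarded edges have distinct lower levels, so their weights are dominated by a geometric series.\<close>

lemma layered_matching_exists:
  fixes w :: "edge \<Rightarrow> real" and lev :: "edge \<Rightarrow> int"
  assumes "0 < \<epsilon>" "\<epsilon> \<le> 1/2" "finite H"
    and "\<And>e. e \<in> H \<Longrightarrow> card e = 2" "\<And>e. e \<in> H \<Longrightarrow> 0 < w e"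
    and "\<And>e e'. e \<in> H \<Longrightarrow> e' \<in> H \<Longrightarrow> lev e = lev e' \<Longrightarrow> e \<noteq> e' \<Longrightarrow> disjnt e e'"
    and "\<And>e e'. e \<in> H \<Longrightarrow> e' \<in> H \<Longrightarrow> lev e < lev e' \<Longrightarrow> w e \<le> \<epsilon> ^ nat (lev e' - lev e) * w e'"
  shows "\<exists>N. is_matching H N \<and> sum w H \<le> (1 + 4 * \<epsilon>) * sum w N"
  using assms(3-)
proof (induction H rule: finite_psubset_induct)
  case (psubset H)
  show ?case
  proof (cases "H = {}")
    case True
    then show ?thesis by (auto simp: is_matching_def)
  next
    case False
    then have "Max (lev ` H) \<in> lev ` H" using psubset.hyps by (intro Max_in) auto
    then obtain a where a: "a \<in> H" "lev a = Max (lev ` H)" by auto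
    then have max: "lev e \<le> lev a" if "e \<in> H" for e using that psubset.hyps by simp
    define F where "F x = {e \<in> H - {a}. x \<in> e}" for x
    have Fsub: "F x \<subseteq> H" and Ffin: "finite (F x)" for x
      using psubset.hyps by (auto simp: F_def)
    have F: "sum w (F x) \<le> 2 * \<epsilon> * w a" if "x \<in> a" for x
    proof -
      have less: "lev e < lev a" if e: "e \<in> F x" for e
      proof -
        have "\<not> disjnt e a" using e \<open>x \<in> a\<close> by (auto simp: F_def disjnt_iff)
        then have "lev e \<noteq> lev a" using e psubset.prems(3)[of e a] a(1) by (auto simp: F_def)
        then show ?thesis using max[of e] e by (auto simp: F_def)
      qed
      have inj: "inj_on (\<lambda>e. nat (lev a - lev e)) (F x)"
      proof (rule inj_onI)
        fix e e' assume ee: "e \<in> F x" "e' \<in> F x" "nat (lev a - lev e) = nat (lev a - lev e')"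
        then have "lev e = lev e'" using less[of e] less[of e'] by simp
        moreover have "\<not> disjnt e e'" using ee by (auto simp: F_def disjnt_iff)
        ultimately show "e = e'" using psubset.prems(3)[of e e'] ee by (auto simp: F_def)
      qed
      have "sum w (F x) \<le> (\<Sum>e\<in>F x. \<epsilon> ^ nat (lev a - lev e) * w a)"
        using less psubset.prems(4) a(1) Fsub by (intro sum_mono) blast
      also have "\<dots> = (\<Sum>e\<in>F x. \<epsilon> ^ nat (lev a - lev e)) * w a"
        by (simp add: sum_distrib_right)
      also have "\<dots> \<le> 2 * \<epsilon> * w a"
        using less psubset.prems(2)[OF a(1)]
        by (intro mult_right_mono geometric_sum_inj_le assms(1,2) Ffin inj) force+
      finally show ?thesis .
    qed
    obtain u v where uv: "a = {u, v}" using psubset.prems(1)[OF a(1)] by (auto simp: card_2_iff)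
    \<comment> \<open>What survives in \<open>H'\<close> avoids both endpoints of \<open>a\<close>,
      so \<open>a\<close> can be added to any matching of \<open>H'\<close>.\<close>
    define H' where "H' = H - {a} - (F u \<union> F v)"
    have disj: "disjnt e a" if "e \<in> H'" for e
      using that by (auto simp: H'_def F_def uv disjnt_iff)
    have "\<exists>N. is_matching H' N \<and> sum w H' \<le> (1 + 4 * \<epsilon>) * sum w N"
      using a(1) by (intro psubset.IH) (auto simp: H'_def intro!: psubset.prems)
    then obtain N where N: "N \<subseteq> H'" "pairwise disjnt N" "sum w H' \<le> (1 + 4 * \<epsilon>) * sum w N"
      by (auto simp: is_matching_def)
    have aN: "a \<notin> N" "finite N"
      using N(1) psubset.hyps by (auto simp: H'_def intro: finite_subset)
    have "is_matching H (insert a N)"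
      unfolding is_matching_def pairwise_insert
    proof (intro conjI ballI allI impI)
      show "insert a N \<subseteq> H" using N(1) a(1) by (auto simp: H'_def)
      show "pairwise disjnt N" by (rule N(2))
      show "disjnt a e" "disjnt e a" if "e \<in> N \<and> e \<noteq> a" for e
        using disj[of e] subsetD[OF N(1)] that by (auto simp: disjnt_sym)
    qed
    moreover have "sum w H \<le> (1 + 4 * \<epsilon>) * sum w (insert a N)"
    proof -
      have nn: "0 \<le> w e" if "e \<in> H" for e using psubset.prems(2)[OF that] by simp
      have "sum w (H - {a}) \<le> sum w (H' \<union> (F u \<union> F v))"
        using psubset.hyps Fsub Ffin nn by (intro sum_mono2) (auto simp: H'_def dest: subsetD[OF Fsub])
      also have "\<dots> \<le> sum w H' + (sum w (F u) + sum w (F v))"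
      proof -
        have "sum w (A \<union> A') \<le> sum w A + sum w A'" if "A \<subseteq> H" "A' \<subseteq> H" for A A'
        proof -
          have "finite A" "finite A'" using that psubset.hyps finite_subset by auto
          then have "sum w (A \<union> A') = sum w A + sum w A' - sum w (A \<inter> A')" by (rule sum_Un)
          moreover have "0 \<le> sum w (A \<inter> A')" using that nn by (intro sum_nonneg) auto
          ultimately show ?thesis by simp
        qed
        from this[of H' "F u \<union> F v"] this[of "F u" "F v"] show ?thesis
          using Fsub by (fastforce simp: H'_def)
      qed
      \<comment> \<open>The 4 is the bound 2\<epsilon> at each of the two endpoints of
        \<open>a\<close>.\<close>
      also have "\<dots> \<le> (1 + 4 * \<epsilon>) * sum w N + 4 * \<epsilon> * w a"
        using N(3) F[of u] F[of v] uv by simp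
      finally have "sum w (H - {a}) \<le> \<dots>" .
      then show ?thesis
        using sum.remove[OF psubset.hyps a(1), of w] aN by (simp add: algebra_simps)
    qed
    ultimately show ?thesis by blast
  qed
qed

section \<open>Weight classes, shifted levels and groups\<close>

definition weight_class :: "real \<Rightarrow> real \<Rightarrow> int" where
  "weight_class \<epsilon> x = \<lfloor>log (1 / \<epsilon>) x\<rfloor>"

text \<open>A level is a block of \<open>K\<close> consecutive classes whose lowest one is congruent
  to \<open>s\<close>. Dropping that class leaves the gap between neighbouring levels.\<close>

definition shifted_level :: "real \<Rightarrow> nat \<Rightarrow> nat \<Rightarrow> real \<Rightarrow> int" where
  "shifted_level \<epsilon> K s x = (weight_class \<epsilon> x - int s) div int K"

text \<open>The group \<open>g\<close> stands for the shift \<open>s = g mod K\<close> and the level \<open>g div K\<close>; levels are only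
  known modulo \<open>\<Lambda>\<close> because no machine knows the minimum weight.\<close>

definition in_group :: "real \<Rightarrow> nat \<Rightarrow> nat \<Rightarrow> nat \<Rightarrow> real \<Rightarrow> bool" where
  "in_group \<epsilon> K \<Lambda> g x \<longleftrightarrow>
     \<not> int K dvd weight_class \<epsilon> x - int (g mod K) \<and>
     shifted_level \<epsilon> K (g mod K) x mod int \<Lambda> = int (g div K)"

lemma weight_class_bounds:
  assumes "0 < \<epsilon>" "\<epsilon> < 1" "0 < x"
  shows "(1 / \<epsilon>) powr weight_class \<epsilon> x \<le> x" "x < (1 / \<epsilon>) powr (weight_class \<epsilon> x + 1)"
  using assms by (auto simp: weight_class_def powr_le_iff less_powr_iff)

text \<open>The extra 1 pays for rounding down the class of \<open>x\<close>. The exponent may be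
  negative, hence \<open>powr\<close>: \<open>k\<close> is minus a level difference for the
  separation of levels, and \<open>K\<close> for the ratio within a level.\<close>

lemma weight_class_le_mult:
  assumes "0 < \<epsilon>" "\<epsilon> < 1" "0 < x" "0 < y"
    and "weight_class \<epsilon> x + 1 \<le> k + weight_class \<epsilon> y"
  shows "x \<le> (1 / \<epsilon>) powr k * y"
proof -
  have "x \<le> (1 / \<epsilon>) powr (weight_class \<epsilon> x + 1)"
    using weight_class_bounds(2)[OF assms(1-3)] by simp
  also have "\<dots> \<le> (1 / \<epsilon>) powr (k + weight_class \<epsilon> y)"
    using assms by (intro powr_mono) auto
  also have "\<dots> = (1 / \<epsilon>) powr k * (1 / \<epsilon>) powr weight_class \<epsilon> y"
    by (simp add: powr_add)
  also have "\<dots> \<le> (1 / \<epsilon>) powr k * y"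
    using weight_class_bounds(1)[OF assms(1,2,4)] by (intro mult_left_mono) auto
  finally show ?thesis .
qed

lemma weight_class_between_levels:
  assumes "0 < K" "\<not> int K dvd weight_class \<epsilon> x - int s" "shifted_level \<epsilon> K s x = l"
  shows "int s + l * int K < weight_class \<epsilon> x" "weight_class \<epsilon> x < int s + (l + 1) * int K"
proof -
  define z where "z = weight_class \<epsilon> x - int s"
  have "z = l * int K + z mod int K" using assms(3) unfolding shifted_level_def z_def by (metis div_mult_mod_eq)
  moreover have "0 < z mod int K"
    using assms(1,2) pos_mod_sign[of "int K" z] unfolding z_def dvd_eq_mod_eq_0 by linarith
  moreover have "z mod int K < int K" using assms(1) by simp
  ultimately show "int s + l * int K < weight_class \<epsilon> x" "weight_class \<epsilon> x < int s + (l + 1) * int K"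
    unfolding z_def distrib_right mult_1 by linarith+
qed

lemma shifted_level_gap:
  assumes "0 < \<epsilon>" "\<epsilon> < 1" "0 < x" "0 < y" "0 < K"
    and "\<not> int K dvd weight_class \<epsilon> x - int s" "\<not> int K dvd weight_class \<epsilon> y - int s"
    and "shifted_level \<epsilon> K s x < shifted_level \<epsilon> K s y"
  shows "x \<le> \<epsilon> ^ nat (shifted_level \<epsilon> K s y - shifted_level \<epsilon> K s x) * y"
proof -
  define l l' where "l = shifted_level \<epsilon> K s x" and "l' = shifted_level \<epsilon> K s y"
  have ll: "l < l'" using assms(8) by (simp add: l_def l'_def)
  \<comment> \<open>The classes differ by at least (l' - l - 1) * K + 2. As K \<ge> 1, this product
    turns that into l' - l + 1: one factor 1/\<epsilon> per level, and one class for
    rounding.\<close>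
  then have "0 \<le> (l' - l - 1) * (int K - 1)" using assms(5) by (intro mult_nonneg_nonneg) auto
  moreover have "weight_class \<epsilon> x < int s + (l + 1) * int K" "int s + l' * int K < weight_class \<epsilon> y"
    using weight_class_between_levels[OF assms(5)] assms(6,7) by (auto simp: l_def l'_def)
  ultimately have "weight_class \<epsilon> x + 1 \<le> - (l' - l) + weight_class \<epsilon> y"
    by (simp add: algebra_simps)
  then have "x \<le> (1 / \<epsilon>) powr (- (l' - l)) * y"
    using weight_class_le_mult[OF assms(1-4), of "- (l' - l)"] by simp
  also have "(1 / \<epsilon>) powr (- (l' - l)) = \<epsilon> powr (real (nat (l' - l)))"
    using assms(1) ll by (simp add: powr_divide powr_diff)
  also have "\<dots> = \<epsilon> ^ nat (l' - l)" using assms(1) by (rule powr_realpow)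
  finally show ?thesis by (simp add: l_def l'_def)
qed

lemma same_level_ratio:
  assumes "0 < \<epsilon>" "\<epsilon> < 1" "0 < x" "0 < y" "0 < K"
    and "\<not> int K dvd weight_class \<epsilon> x - int s" "\<not> int K dvd weight_class \<epsilon> y - int s"
    and "shifted_level \<epsilon> K s x = shifted_level \<epsilon> K s y"
  shows "x \<le> (1 / \<epsilon>) ^ K * y"
proof -
  have "weight_class \<epsilon> x + 1 \<le> int K + weight_class \<epsilon> y"
    using weight_class_between_levels[OF assms(5,6,8)] weight_class_between_levels[OF assms(5,7) refl]
    by (simp add: algebra_simps)
  from weight_class_le_mult[OF assms(1-4) this] show ?thesis
    using assms(1) by (simp add: powr_realpow)
qed

lemma int_mod_eq_abs_less:
  fixes a b m :: int
  assumes "a mod m = b mod m" "\<bar>a - b\<bar> < m"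
  shows "a = b"
  using assms by (metis mod_eq_dvd_iff zdvd_not_zless abs_of_nonneg abs_of_nonpos dvd_minus_iff
      diff_0_right eq_iff_diff_eq_0 linorder_le_cases zero_less_abs_iff dvd_abs_iff)

text \<open>Levels occurring in a graph of ratio \<open>W\<close> differ by less than
  \<open>\<Lambda>\<close>, so their residues modulo \<open>\<Lambda>\<close> identify them.\<close>

lemma in_group_same_level:
  assumes "0 < \<epsilon>" "\<epsilon> < 1" "0 < x" "0 < y" "0 < K" "1 \<le> W" "x \<le> W * y" "y \<le> W * x"
    and \<Lambda>: "\<Lambda> = nat \<lfloor>log (1 / \<epsilon>) W / K\<rfloor> + 3"
    and "in_group \<epsilon> K \<Lambda> g x" "in_group \<epsilon> K \<Lambda> g y"
  shows "shifted_level \<epsilon> K (g mod K) x = shifted_level \<epsilon> K (g mod K) y"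
proof -
  define L where "L = log (1 / \<epsilon>) W"
  have L: "0 \<le> L" using assms(1,2,6) by (simp add: L_def)
  have le: "real_of_int (shifted_level \<epsilon> K s x - shifted_level \<epsilon> K s y) < \<Lambda>"
    if "0 < x" "0 < y" "x \<le> W * y" for x y s
  proof -
    have "log (1 / \<epsilon>) x \<le> log (1 / \<epsilon>) (W * y)"
      using assms(1,2) that by (subst log_le_cancel_iff) auto
    also have "\<dots> = L + log (1 / \<epsilon>) y"
      using assms(1,2,6) that by (simp add: L_def log_mult)
    finally have "weight_class \<epsilon> x - weight_class \<epsilon> y < L + 1"
      unfolding weight_class_def by linarith
    moreover define a b where "a = weight_class \<epsilon> x - int s" and "b = weight_class \<epsilon> y - int s"
    ultimately have ab: "a - b < L + 1" by simp
    have "real_of_int (a div int K) \<le> a / K"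
      by (metis of_int_of_nat_eq real_of_int_div4)
    moreover have "b / K - 1 < real_of_int (b div int K)"
      using real_of_int_div3[of b "int K"] assms(5)
      by (metis add.commute diff_less_eq floor_divide_of_int_eq of_int_of_nat_eq real_of_int_floor_add_one_gt)
    ultimately have "real_of_int (a div int K - b div int K) < (a - b) / K + 1"
      by (simp add: diff_divide_distrib)
    also have "\<dots> \<le> (L + 1) / K + 1"
      using ab assms(5) by (simp add: divide_right_mono)
    also have "\<dots> \<le> L / K + 2" using assms(5) by (simp add: field_simps)
    \<comment> \<open>Origin of the 3 in \<open>\<Lambda>\<close>: rounding the classes adds 1 to
      \<open>L\<close>, rounding the division by \<open>K\<close> adds 1 to the quotient, and the
      floor of L / K loses less than 1.\<close>
    also have "\<dots> < \<Lambda>" using L assms(5) unfolding \<Lambda> L_def[symmetric] by simp linarith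
    finally show ?thesis by (simp add: shifted_level_def a_def b_def)
  qed
  show ?thesis
  proof (rule int_mod_eq_abs_less)
    show "shifted_level \<epsilon> K (g mod K) x mod int \<Lambda> = shifted_level \<epsilon> K (g mod K) y mod int \<Lambda>"
      using assms(10,11) by (simp add: in_group_def)
    show "\<bar>shifted_level \<epsilon> K (g mod K) x - shifted_level \<epsilon> K (g mod K) y\<bar> < int \<Lambda>"
      using le[OF assms(3,4,7), of "g mod K"] le[OF assms(4,3,8), of "g mod K"] by linarith
  qed
qed

text \<open>Every element is dropped by exactly one of the \<open>K\<close> shifts, so the dropped
  weights add up to \<open>sum w M\<close> and not all of them exceed the average.\<close>

lemma average_shift:
  fixes w :: "'a \<Rightarrow> real"
  assumes "0 < K" "finite M" "\<And>e. e \<in> M \<Longrightarrow> 0 \<le> w e"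
  shows "\<exists>s<K. real K * sum w {e \<in> M. int K dvd z e - int s} \<le> sum w M"
proof (rule ccontr)
  assume "\<not> ?thesis"
  then have gt: "sum w M / K < sum w {e \<in> M. int K dvd z e - int s}" if "s < K" for s
    using that assms(1) by (auto simp: field_simps not_le)
  have eq: "{e \<in> M. int K dvd z e - int s} = {e \<in> M. nat (z e mod int K) = s}" if "s < K" for s
  proof -
    have "int K dvd z e - int s \<longleftrightarrow> nat (z e mod int K) = s" for e
      using that assms(1) by (simp add: mod_eq_dvd_iff[symmetric] nat_eq_iff)
    then show ?thesis by simp
  qed
  have "sum w M = (\<Sum>s<K. sum w M / K)" using assms(1) by simp
  also have "\<dots> < (\<Sum>s<K. sum w {e \<in> M. int K dvd z e - int s})"
    using gt assms(1) by (intro sum_strict_mono) auto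
  also have "\<dots> = (\<Sum>s<K. sum w {e \<in> M. nat (z e mod int K) = s})"
    using eq by (intro sum.cong) auto
  also have "\<dots> = sum w M"
    using assms(1,2) by (intro sum.group) (auto simp: nat_less_iff)
  finally show False by simp
qed

text \<open>One good shift suffices: \<open>N\<close> is optimal in the union over all shifts, hence
  at least as heavy as the matching assembled from the groups of that shift. The shift is chosen
  separately for each competitor \<open>Q\<close>.\<close>

lemma grouped_matchings_approx:
  assumes \<epsilon>: "0 < \<epsilon>" "\<epsilon> < 1/2" and K: "1 / \<epsilon> \<le> real K" and "0 < \<Lambda>"
    and E: "simple_graph n E" and w: "\<And>e. e \<in> E \<Longrightarrow> 0 < w e"
    and M: "\<And>g. g < K * \<Lambda> \<Longrightarrow>
      approx_max_weight_matching (1 + \<epsilon>) {e \<in> E. in_group \<epsilon> K \<Lambda> g (w e)} w (M g)"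
    and N: "is_max_weight_matching (\<Union>g<K * \<Lambda>. M g) w N"
  shows "approx_max_weight_matching (1 + 16 * \<epsilon>) E w N"
proof -
  have finE: "finite E" using E by (rule simple_graph_finite)
  have K0: "0 < K" using K \<epsilon>(1) by (metis divide_pos_pos less_le_trans of_nat_0_less_iff zero_less_one)
  have M_sub: "M g \<subseteq> {e \<in> E. in_group \<epsilon> K \<Lambda> g (w e)}" "pairwise disjnt (M g)" if "g < K * \<Lambda>" for g
    using M[OF that] by (auto simp: approx_max_weight_matching_def is_matching_def)
  have opt: "sum w Q \<le> (1 + 16 * \<epsilon>) * sum w N" if "is_matching E Q" for Q
  proof -
    have Q: "Q \<subseteq> E" "pairwise disjnt Q" using that by (auto simp: is_matching_def)
    have finQ: "finite Q" using Q(1) finE by (rule finite_subset)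
    obtain s where s: "s < K"
      and s_le: "real K * sum w {e \<in> Q. int K dvd weight_class \<epsilon> (w e) - int s} \<le> sum w Q"
      using average_shift[OF K0 finQ, of w "\<lambda>e. weight_class \<epsilon> (w e)"] Q(1) w
      by (meson less_imp_le subsetD)
    define Q' where "Q' = {e \<in> Q. \<not> int K dvd weight_class \<epsilon> (w e) - int s}"
    define Z where "Z = {e \<in> Q. int K dvd weight_class \<epsilon> (w e) - int s}"
    have "0 \<le> sum w Z" using Q(1) w by (intro sum_nonneg) (force simp: Z_def)
    have "1 / \<epsilon> * sum w Z \<le> real K * sum w Z"
      using K \<open>0 \<le> sum w Z\<close> by (rule mult_right_mono)
    also have "\<dots> \<le> sum w Q" using s_le by (simp add: Z_def)
    finally have "sum w Z \<le> \<epsilon> * sum w Q" using \<epsilon>(1) by (simp add: field_simps)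
    moreover have "sum w Q = sum w Z + sum w Q'"
      using sum.union_disjoint[of Z Q' w] finQ
      by (simp add: Z_def Q'_def Int_def Un_def conj_disj_distribL[symmetric] cong: conj_cong)
    ultimately have Q'_ge: "(1 - \<epsilon>) * sum w Q \<le> sum w Q'" by (simp add: algebra_simps)
    \<comment> \<open>Layering uses the true level, whereas a group sees only its residue modulo
      \<open>\<Lambda>\<close>. Equal levels have equal residues, so such edges of \<open>H\<close>
      come from one matching \<open>M (s + K * r)\<close> and are disjoint.\<close>
    define lev where "lev e = shifted_level \<epsilon> K s (w e)" for e
    have idx: "(s + K * r) mod K = s" "(s + K * r) div K = r" for r using s by auto
    have grp: "s + K * r < K * \<Lambda>" if "r < \<Lambda>" for r
    proof -
      have "s + K * r < K * Suc r" using s by simp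
      also have "\<dots> \<le> K * \<Lambda>" using that by (intro mult_le_mono2) simp
      finally show ?thesis .
    qed
    have in_grp: "in_group \<epsilon> K \<Lambda> (s + K * r) (w e) \<longleftrightarrow>
        \<not> int K dvd weight_class \<epsilon> (w e) - int s \<and> lev e mod int \<Lambda> = int r" for r e
      unfolding in_group_def idx lev_def ..
    define H where "H = (\<Union>r<\<Lambda>. M (s + K * r))"
    have H_E: "e \<in> E" "\<not> int K dvd weight_class \<epsilon> (w e) - int s" if "e \<in> H" for e
      using that M_sub(1)[OF grp] by (auto simp: H_def in_grp)
    have finM: "finite (M (s + K * r))" if "r < \<Lambda>" for r
      by (rule finite_subset[OF M_sub(1)[OF grp[OF that]]]) (use finE in simp)
    have "sum w Q' = (\<Sum>r<\<Lambda>. sum w {e \<in> Q'. nat (lev e mod int \<Lambda>) = r})"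
      using finQ assms(4) by (intro sum.group[symmetric]) (auto simp: Q'_def nat_less_iff)
    also have "\<dots> \<le> (\<Sum>r<\<Lambda>. (1 + \<epsilon>) * sum w (M (s + K * r)))"
    proof (rule sum_mono)
      fix r assume "r \<in> {..<\<Lambda>}"
      then have r: "r < \<Lambda>" by simp
      have "is_matching {e \<in> E. in_group \<epsilon> K \<Lambda> (s + K * r) (w e)} {e \<in> Q'. nat (lev e mod int \<Lambda>) = r}"
        using Q assms(4) by (auto simp: is_matching_def Q'_def in_grp pairwise_def)
      then show "sum w {e \<in> Q'. nat (lev e mod int \<Lambda>) = r} \<le> (1 + \<epsilon>) * sum w (M (s + K * r))"
        using M[OF grp[OF r]] finE by (simp add: approx_max_weight_matching_iff)
    qed
    also have "\<dots> = (1 + \<epsilon>) * sum w H"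
    proof -
      have "M (s + K * r) \<inter> M (s + K * r') = {}" if "r < \<Lambda>" "r' < \<Lambda>" "r \<noteq> r'" for r r'
        using M_sub(1)[OF grp[OF that(1)]] M_sub(1)[OF grp[OF that(2)]] that(3)
        unfolding in_grp by force
      then have "sum w H = (\<Sum>r<\<Lambda>. sum w (M (s + K * r)))"
        unfolding H_def using finM by (intro sum.UNION_disjoint) auto
      then show ?thesis by (simp add: sum_distrib_left)
    qed
    finally have Q'_le: "sum w Q' \<le> (1 + \<epsilon>) * sum w H" .
    have "\<exists>N'. is_matching H N' \<and> sum w H \<le> (1 + 4 * \<epsilon>) * sum w N'"
    proof (rule layered_matching_exists[where lev = lev])
      show "finite H" using finM by (auto simp: H_def)
      show "card e = 2" if "e \<in> H" for e using simple_graph_card2[OF E] H_E(1)[OF that] .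
      show "0 < w e" if "e \<in> H" for e using w H_E(1)[OF that] .
      show "w e \<le> \<epsilon> ^ nat (lev e' - lev e) * w e'" if "e \<in> H" "e' \<in> H" "lev e < lev e'" for e e'
        using that \<epsilon> K0 H_E w unfolding lev_def by (intro shifted_level_gap) auto
      show "disjnt e e'" if e: "e \<in> H" "e' \<in> H" "lev e = lev e'" "e \<noteq> e'" for e e'
      proof -
        obtain r r' where r: "r < \<Lambda>" "e \<in> M (s + K * r)" "r' < \<Lambda>" "e' \<in> M (s + K * r')"
          using e by (auto simp: H_def)
        then have "lev e mod int \<Lambda> = int r" "lev e' mod int \<Lambda> = int r'"
          using M_sub(1)[OF grp] in_grp by blast+
        then have "r = r'" using e(3) by simp
        then show ?thesis using r M_sub(2)[OF grp] e(4) by (auto simp: pairwise_def)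
      qed
    qed (use \<epsilon> in auto)
    then obtain N' where N': "is_matching H N'" "sum w H \<le> (1 + 4 * \<epsilon>) * sum w N'" by blast
    have "is_matching (\<Union>g<K * \<Lambda>. M g) N'"
      using N'(1) grp by (fastforce simp: is_matching_def H_def)
    then have N'_le: "sum w N' \<le> sum w N"
      using N by (simp add: is_max_weight_matching_def)
    moreover have "0 \<le> sum w N'"
      using N'(1) H_E(1) w by (intro sum_nonneg) (force simp: is_matching_def)
    ultimately have "0 \<le> sum w N" by simp
    have "(1 - \<epsilon>) * sum w Q \<le> (1 + \<epsilon>) * ((1 + 4 * \<epsilon>) * sum w N)"
      using Q'_ge Q'_le N'(2) N'_le \<epsilon>(1)
      by (smt (verit) mult_left_mono)
    also have "\<dots> \<le> (1 - \<epsilon>) * ((1 + 16 * \<epsilon>) * sum w N)"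
    proof -
      \<comment> \<open>This is the difference of the two sides of the next inequality. It vanishes
        at \<epsilon> = 1/2, which is why the coefficient is 16.\<close>
      have "0 \<le> 10 * (\<epsilon> * (1 - 2 * \<epsilon>))" using \<epsilon> by simp
      then have "(1 + \<epsilon>) * (1 + 4 * \<epsilon>) \<le> (1 - \<epsilon>) * (1 + 16 * \<epsilon>)"
        by (simp add: algebra_simps)
      from mult_right_mono[OF this \<open>0 \<le> sum w N\<close>] show ?thesis by (simp add: mult.assoc)
    qed
    finally show ?thesis using \<epsilon> by simp
  qed
  have "(\<Union>g<K * \<Lambda>. M g) \<subseteq> E" using M_sub(1) by blast
  then have "is_matching E N"
    using N unfolding is_max_weight_matching_def is_matching_def by blast
  then show ?thesis using opt approx_max_weight_matching_iff[OF finE] by blast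
qed

section \<open>Running a network on several subgraphs in parallel\<close>

lemma length_encode [simp]: "length (encode c es) = 3 * length es"
  by (induction es) (auto simp: encode_def)

lemma encode_Nil [simp]: "encode c [] = []"
  by (simp add: encode_def)

lemma encode_Cons [simp]: "encode c (e # es) = Min e # Max e # c e # encode c es"
  by (simp add: encode_def)

lemma encode_append: "encode c (es @ es') = encode c es @ encode c es'"
  by (simp add: encode_def)

lemma encode_concat: "encode c (concat ess) = concat (map (encode c) ess)"
  by (induction ess) (auto simp: encode_append)

lemma encode_eq_Nil_iff [simp]: "encode c es = [] \<longleftrightarrow> es = []"
  by (cases es) auto

lemma set_encode: "set (encode c es) = (\<Union>e\<in>set es. {Min e, Max e, c e})"
  by (auto simp: encode_def)

lemma encode_cong: "(\<And>e. e \<in> set es \<Longrightarrow> c e = c' e) \<Longrightarrow> encode c es = encode c' es"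
  by (induction es) auto

text \<open>Lets a network cut out a single edge by word positions, without decoding its
  memory.\<close>

lemma encode_single_edge: "encode c (take 1 (drop k es)) = take 3 (drop (3 * k) (encode c es))"
proof (induction es arbitrary: k)
  case (Cons e es)
  then show ?case
    by (cases k) (simp_all add: numeral_3_eq_3)
qed simp

lemma card2_Min_Max: "card (e :: nat set) = 2 \<Longrightarrow> {Min e, Max e} = e"
  by (auto simp: card_2_iff min_def max_def split: if_splits)

text \<open>A two-element set is determined by its minimum and maximum. So edges and weight codes
  can be recovered from bare words, which is all that local computation sees.\<close>

lemma encode_inject:
  assumes "encode c es = encode c' es'"
    and "\<And>e. e \<in> set es \<Longrightarrow> card e = 2" "\<And>e. e \<in> set es' \<Longrightarrow> card e = 2"
  shows "es = es' \<and> (\<forall>e\<in>set es. c e = c' e)"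
  using assms
proof (induction es arbitrary: es')
  case Nil
  then have "encode c' es' = []" by simp
  then show ?case by simp
next
  case (Cons e es)
  from Cons.prems(1) obtain e' es'' where es': "es' = e' # es''" by (cases es') auto
  have eq: "Min e = Min e'" "Max e = Max e'" "c e = c' e'" "encode c es = encode c' es''"
    using Cons.prems(1) unfolding es' by simp_all
  have "e = {Min e, Max e}" using Cons.prems(2) by (simp add: card2_Min_Max)
  also have "\<dots> = e'" unfolding eq using Cons.prems(3) es' by (simp add: card2_Min_Max)
  finally have "e = e'" .
  moreover have "es = es'' \<and> (\<forall>e\<in>set es. c e = c' e)"
    using Cons.prems(2,3) es' by (intro Cons.IH[OF eq(4)]) simp_all
  ultimately show ?case using eq(3) es' by simp
qed

section \<open>Concatenations and sums over blocks of indices\<close>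

lemma concat_map_single:
  "concat (map (\<lambda>i. if i = a then f i else []) [0..<k]) = (if a < k then f a else [])"
  by (induction k) auto

lemma concat_map_blocks:
  "concat (map f [0..<a * b]) = concat (map (\<lambda>i. concat (map (\<lambda>k. f (i * b + k)) [0..<b])) [0..<a])"
proof (induction a)
  case (Suc a)
  have "[0..<Suc a * b] = [0..<a * b] @ map (\<lambda>k. a * b + k) [0..<b]"
    using upt_add_eq_append[of 0 "a * b" b] map_add_upt[of "a * b" b] by (simp add: add.commute)
  then show ?case using Suc by (simp add: comp_def)
qed simp

lemma concat_map_block:
  assumes "g < a"
  shows "concat (map (\<lambda>i. if i div b = g then f (i mod b) else []) [0..<a * b]) = concat (map f [0..<b])"
proof -
  have "concat (map (\<lambda>k. if (i * b + k) div b = g then f ((i * b + k) mod b) else []) [0..<b])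
      = (if i = g then concat (map f [0..<b]) else [])" for i
    by (auto intro!: arg_cong[of _ _ concat] map_cong)
  then show ?thesis using assms by (simp add: concat_map_blocks concat_map_single)
qed

text \<open>Slots beyond the end of the list are empty, so one slot number \<open>h\<close> can
  serve lists of different lengths.\<close>

lemma concat_singletons:
  "length xs \<le> h \<Longrightarrow> concat (map (\<lambda>k. take 1 (drop k xs)) [0..<h]) = xs"
proof (induction h arbitrary: xs)
  case (Suc h)
  show ?case
  proof (cases xs)
    case Nil
    then show ?thesis by simp
  next
    case (Cons y ys)
    have "map (\<lambda>k. take 1 (drop k xs)) [0..<Suc h] = [y] # map (\<lambda>k. take 1 (drop k ys)) [0..<h]"
      unfolding upt_conv_Cons[OF zero_less_Suc] map_Suc_upt[symmetric] by (simp add: Cons)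
    then show ?thesis using Suc Cons by simp
  qed
qed simp

lemma sum_length_concat: "(\<Sum>i<k. length (f i)) = length (concat (map f [0..<k]))"
  by (induction k) auto

lemma sum_blocks:
  fixes f :: "nat \<Rightarrow> nat"
  shows "(\<Sum>i<a * b. f i) = (\<Sum>g<a. \<Sum>i<b. f (g * b + i))"
proof -
  have "(\<Sum>i<a * b. f i) = (\<Sum>g<a. sum f {g * b..<g * b + b})" by (simp add: sum.nat_group)
  also have "\<dots> = (\<Sum>g<a. \<Sum>i<b. f (g * b + i))"
    by (simp add: sum.atLeastLessThan_shift_0[of _ _ "_ + b"] atLeast0LessThan comp_def)
  finally show ?thesis .
qed

text \<open>Inside one block \<open>j mod b\<close> determines \<open>j\<close>, so no summand of
  \<open>f\<close> is used twice.\<close>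

lemma sum_in_block_le:
  fixes f :: "nat \<Rightarrow> nat"
  assumes "finite J" "finite A" "\<And>j. j \<in> J \<Longrightarrow> j div b = i \<Longrightarrow> j mod b \<in> A"
  shows "(\<Sum>j\<in>J. if j div b = i then f (j mod b) else 0) \<le> sum f A"
proof -
  have "(\<Sum>j\<in>J. if j div b = i then f (j mod b) else 0) = (\<Sum>j\<in>{j \<in> J. j div b = i}. f (j mod b))"
    using assms(1) by (simp add: sum.inter_filter)
  also have "\<dots> = sum f ((\<lambda>j. j mod b) ` {j \<in> J. j div b = i})"
    by (subst sum.reindex) (auto intro!: inj_onI, metis div_mult_mod_eq)
  also have "\<dots> \<le> sum f A" using assms by (intro sum_mono2) auto
  finally show ?thesis .
qed

text \<open>Each of the \<open>G\<close> groups owns a block of \<open>machines N\<close> consecutive machines running \<open>N\<close>.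
  Round 0 puts every edge on a machine of its own, since a full machine could not send
  several copies of all its edges; round 1 copies the edge into the groups selecting its weight code.
  After the \<open>r\<close> simulated rounds, machine 0 gathers all results and postprocesses them by \<open>out\<close>.\<close>

definition bucketed_network ::
  "(nat \<Rightarrow> nat \<Rightarrow> bool) \<Rightarrow> (nat list \<Rightarrow> nat list) \<Rightarrow> nat \<Rightarrow> nat \<Rightarrow> nat \<Rightarrow> network \<Rightarrow> network" where
  "bucketed_network sel out G h r N =
    \<lparr>machines = G * machines N,
     send = (\<lambda>t i x j.
       if t = 0 then (if i = j div h then take 3 (drop (3 * (j mod h)) x) else [])
       else if t = 1 then
         (if i = j mod machines N then (if sel (j div machines N) (x ! 2) then x else []) else [])
       else if t < r + 2 then
         (if i div machines N = j div machines N
          then send N (t - 2) (i mod machines N) x (j mod machines N) else [])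
       else if t = r + 2 then (if j = 0 then x else [])
       else (if i = 0 then (if j = 0 then out x else []) else []))\<rparr>"

text \<open>Machine \<open>j\<close> takes slot \<open>j mod h\<close> of input machine
  \<open>j div h\<close>. By \<open>D_length\<close> the slots suffice, and by \<open>fit\<close>
  all \<open>p * h\<close> of them lie in one block, so that in every block the same positions act
  as input machines of \<open>N\<close>.\<close>

locale bucketed_run =
  fixes sel :: "nat \<Rightarrow> nat \<Rightarrow> bool" and out :: "nat list \<Rightarrow> nat list"
    and G h r p :: nat and N :: network
    and c :: "edge \<Rightarrow> nat" and D :: "nat \<Rightarrow> edge list" and E :: "edge set"
  assumes G_pos: "0 < G" and h_pos: "0 < h"
    and fit: "p * h \<le> machines N" and p_le: "p \<le> machines N"
    and D_length: "\<And>i. i < p \<Longrightarrow> length (D i) \<le> h"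
    and D: "distributed p D E"
begin

abbreviation "q \<equiv> machines N"

abbreviation "P \<equiv> bucketed_network sel out G h r N"

abbreviation "x \<equiv> initial_memory p c D"

definition piece :: "nat \<Rightarrow> edge list" where
  "piece j = take 1 (drop (j mod h) (D (j div h)))"

definition group_input :: "nat \<Rightarrow> nat \<Rightarrow> edge list" where
  "group_input g j = filter (\<lambda>e. sel g (c e)) (piece j)"

abbreviation "y g \<equiv> initial_memory (p * h) c (group_input g)"

lemma machines_P [simp]: "machines P = G * q"
  by (simp add: bucketed_network_def)

lemma index_split:
  assumes "j < G * q"
  shows "j div q < G" "j mod q < q" "j div q * q + j mod q = j"
proof -
  have "0 < q" using assms by (auto intro: gr_zeroI)
  then show "j div q < G" "j mod q < q" "j div q * q + j mod q = j"
    using assms by (auto simp: less_mult_imp_div_less)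
qed

lemma q_le: "q \<le> G * q"
  using G_pos by simp

lemma piece_cases: "piece j = [] \<or> (\<exists>e. piece j = [e])"
  unfolding piece_def by (cases "drop (j mod h) (D (j div h))") auto

lemma concat_pieces: "concat (map piece [0..<p * h]) = concat (map D [0..<p])"
proof -
  have "concat (map (\<lambda>k. piece (i * h + k)) [0..<h]) = D i" if "i < p" for i
  proof -
    have "map (\<lambda>k. piece (i * h + k)) [0..<h] = map (\<lambda>k. take 1 (drop k (D i))) [0..<h]"
      using h_pos by (auto simp: piece_def)
    then show ?thesis using concat_singletons[OF D_length[OF that]] by (simp only:)
  qed
  then show ?thesis
    by (auto simp: concat_map_blocks intro!: arg_cong[of _ _ concat])
qed

lemma distributed_group_input: "distributed (p * h) (group_input g) {e \<in> E. sel g (c e)}"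
proof -
  have "concat (map (group_input g) [0..<p * h]) = filter (\<lambda>e. sel g (c e)) (concat (map D [0..<p]))"
    unfolding concat_pieces[symmetric] filter_concat by (simp add: group_input_def[abs_def] comp_def)
  then show ?thesis using D by (auto simp: distributed_def)
qed

section \<open>Memory contents after each round\<close>

lemma memory_1:
  assumes "j < G * q"
  shows "memory P x 1 j = (if j < p * h then encode c (piece j) else [])"
proof -
  have "memory P x 1 j =
      concat (map (\<lambda>i. if i = j div h then take 3 (drop (3 * (j mod h)) (x i)) else []) [0..<G * q])"
    by (simp add: bucketed_network_def)
  \<comment> \<open>The sender \<open>j div h\<close> is a valid index because it is at most
    \<open>j\<close>.\<close>
  also have "\<dots> = take 3 (drop (3 * (j mod h)) (x (j div h)))"
    using assms by (subst concat_map_single) (meson div_le_dividend le_less_trans)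
  also have "\<dots> = (if j < p * h then encode c (piece j) else [])"
    using h_pos
    by (simp add: initial_memory_def piece_def encode_single_edge[symmetric]
        div_less_iff_less_mult del: One_nat_def)
  finally show ?thesis .
qed

lemma memory_2:
  assumes "g < G" "i < q"
  shows "memory P x 2 (g * q + i) = y g i"
proof -
  have i: "i < G * q" using assms(2) q_le by (rule less_le_trans)
  have "memory P x (Suc 1) (g * q + i) =
      concat (map (\<lambda>i'. if i' = i then
        (if sel g (memory P x 1 i' ! 2) then memory P x 1 i' else []) else []) [0..<G * q])"
    unfolding memory.simps(2) machines_P using assms
    by (intro arg_cong[of _ _ concat] map_cong) (auto simp: bucketed_network_def)
  also have "\<dots> = (if sel g (memory P x 1 i ! 2) then memory P x 1 i else [])"
    using i by (subst concat_map_single) simp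
  \<comment> \<open>For an empty memory the word at position 2 is unspecified, but both branches
    then send nothing.\<close>
  also have "\<dots> = y g i"
    using piece_cases[of i] unfolding memory_1[OF i]
    by (auto simp: initial_memory_def group_input_def)
  also have "Suc 1 = (2 :: nat)" by simp
  finally show ?thesis .
qed

text \<open>No messages cross block borders during the simulation, so each block evolves like
  \<open>N\<close> on its own group. The offset 2 stands for the distribution rounds.\<close>

lemma memory_group:
  assumes "t \<le> r" "g < G" "i < q"
  shows "memory P x (t + 2) (g * q + i) = memory N (y g) t i"
  using assms(1,3)
proof (induction t arbitrary: i)
  case 0
  then show ?case using memory_2[OF assms(2)] by (simp only: add_0 memory.simps(1))
next
  case (Suc t)
  have IH: "memory P x (t + 2) (g * q + k) = memory N (y g) t k" if "k < q" for k
    using Suc that by simp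
  have "memory P x (Suc t + 2) (g * q + i) =
      concat (map (\<lambda>i'. if i' div q = g then send N t (i' mod q) (memory P x (t + 2) i') i else [])
        [0..<G * q])"
    using Suc.prems unfolding add_Suc memory.simps(2) machines_P
    by (intro arg_cong[of _ _ concat] map_cong) (auto simp: bucketed_network_def)
  also have "\<dots> = concat (map (\<lambda>i'. if i' div q = g then
      (\<lambda>k. send N t k (memory N (y g) t k) i) (i' mod q) else []) [0..<G * q])"
  proof (intro arg_cong[of _ _ concat] map_cong refl)
    fix i' assume "i' \<in> set [0..<G * q]"
    then have "i' mod q < q" "i' div q * q + i' mod q = i'" using index_split by auto
    then show "(if i' div q = g then send N t (i' mod q) (memory P x (t + 2) i') i else []) =
       (if i' div q = g then (\<lambda>k. send N t k (memory N (y g) t k) i) (i' mod q) else [])"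
      using IH[of "i' mod q"] by (metis (no_types))
  qed
  also have "\<dots> = memory N (y g) (Suc t) i"
    unfolding memory.simps(2) by (rule concat_map_block[OF assms(2)])
  finally show ?case .
qed

lemma memory_group':
  "t \<le> r \<Longrightarrow> j < G * q \<Longrightarrow> memory P x (t + 2) j = memory N (y (j div q)) t (j mod q)"
  using memory_group[of t "j div q" "j mod q"] by (simp only: index_split)

lemma memory_gather:
  "memory P x (r + 3) j = (if j = 0 then concat (map (memory P x (r + 2)) [0..<G * q]) else [])"
proof -
  have "memory P x (Suc (r + 2)) j =
      concat (map (\<lambda>i. if j = 0 then memory P x (r + 2) i else []) [0..<G * q])"
    unfolding memory.simps(2) machines_P
    by (intro arg_cong[of _ _ concat] map_cong) (auto simp: bucketed_network_def)
  moreover have "Suc (r + 2) = r + 3" by simp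
  ultimately have "memory P x (r + 3) j =
      concat (map (\<lambda>i. if j = 0 then memory P x (r + 2) i else []) [0..<G * q])"
    by (simp only:)
  then show ?thesis by (cases "j = 0") (simp_all only: if_True if_False refl, simp)
qed

lemma memory_final:
  assumes "j < G * q"
  shows "memory P x (r + 4) j = (if j = 0 then out (memory P x (r + 3) 0) else [])"
proof -
  have "memory P x (Suc (r + 3)) j =
      concat (map (\<lambda>i. if i = 0 then (if j = 0 then out (memory P x (r + 3) i) else []) else []) [0..<G * q])"
    unfolding memory.simps(2) machines_P
    by (intro arg_cong[of _ _ concat] map_cong) (auto simp: bucketed_network_def)
  also have "\<dots> = (if j = 0 then out (memory P x (r + 3) 0) else [])"
    using assms by (subst concat_map_single) auto
  also have "Suc (r + 3) = r + 4" by simp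
  finally show ?thesis .
qed

section \<open>Space and communication in each phase\<close>

lemma total_initial: "(\<Sum>i<p. length (x i)) = 3 * card E"
proof -
  have "(\<Sum>i<p. length (x i)) = (\<Sum>i<p. 3 * length (D i))"
    by (intro sum.cong) (auto simp: initial_memory_def)
  also have "\<dots> = 3 * length (concat (map D [0..<p]))"
    by (simp add: sum_distrib_left[symmetric] sum_length_concat)
  also have "\<dots> = 3 * card E"
    using D by (auto simp: distributed_def distinct_card[symmetric])
  finally show ?thesis .
qed

lemma total_memory_0: "(\<Sum>i<G * q. length (memory P x 0 i)) = 3 * card E"
proof -
  have "(\<Sum>i<G * q. length (x i)) = (\<Sum>i<p. length (x i))"
    using le_trans[OF p_le q_le] by (intro sum.mono_neutral_right) (auto simp: initial_memory_def)
  then show ?thesis using total_initial by simp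
qed

lemma total_memory_1: "(\<Sum>i<G * q. length (memory P x 1 i)) = 3 * card E"
proof -
  have "(\<Sum>i<G * q. length (memory P x 1 i)) = (\<Sum>i<G * q. if i < p * h then 3 * length (piece i) else 0)"
    by (intro sum.cong refl) (simp add: memory_1 del: One_nat_def memory.simps)
  also have "\<dots> = (\<Sum>i<p * h. if i < p * h then 3 * length (piece i) else 0)"
    using le_trans[OF fit q_le] by (intro sum.mono_neutral_right) auto
  also have "\<dots> = 3 * length (concat (map piece [0..<p * h]))"
    by (simp add: sum_distrib_left[symmetric] sum_length_concat)
  also have "\<dots> = 3 * card E"
    using D unfolding concat_pieces by (auto simp: distributed_def distinct_card[symmetric])
  finally show ?thesis .
qed

lemma piece_subset: "j < p * h \<Longrightarrow> set (piece j) \<subseteq> E"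
proof -
  assume "j < p * h"
  then have "set (piece j) \<subseteq> set (concat (map piece [0..<p * h]))" by auto
  then show ?thesis using D unfolding concat_pieces distributed_def by simp
qed

lemma input_subset: "i < p \<Longrightarrow> set (D i) \<subseteq> E"
  using D by (auto simp: distributed_def)

text \<open>The slots of a machine hold disjoint parts of its list, so spreading sends each edge
  only once.\<close>

lemma send_0_le:
  assumes "i < G * q" "finite J"
  shows "(\<Sum>j\<in>J. length (send P 0 i (x i) j)) \<le> length (x i)"
proof (cases "i < p")
  case True
  have "(\<Sum>j\<in>J. length (send P 0 i (x i) j)) =
      (\<Sum>j\<in>J. if j div h = i then length (encode c (take 1 (drop (j mod h) (D i)))) else 0)"
    unfolding encode_single_edge using True
    by (intro sum.cong) (auto simp: bucketed_network_def initial_memory_def)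
  also have "\<dots> \<le> (\<Sum>k<h. length (encode c (take 1 (drop k (D i)))))"
    using assms(2) h_pos
    by (intro sum_in_block_le[where f = "\<lambda>k. length (encode c (take 1 (drop k (D i))))"]) auto
  also have "\<dots> = 3 * length (concat (map (\<lambda>k. take 1 (drop k (D i))) [0..<h]))"
    unfolding length_encode sum_distrib_left[symmetric] sum_length_concat ..
  also have "\<dots> = length (x i)"
    unfolding concat_singletons[OF D_length[OF True]] using True by (simp add: initial_memory_def)
  finally show ?thesis .
next
  case False
  then have "length (send P 0 i (x i) j) = 0" for j
    by (simp add: bucketed_network_def initial_memory_def)
  then show ?thesis by simp
qed

lemma memory_1_length:
  assumes "i < G * q"
  shows "length (memory P x 1 i) \<le> (if E = {} then 0 else 3)"
  using piece_cases[of i] piece_subset[of i] unfolding memory_1[OF assms] by auto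

text \<open>The recipients of machine \<open>i\<close> are congruent to \<open>i\<close> modulo
  \<open>q\<close>, at most one in each of the \<open>G\<close> blocks.\<close>

lemma send_1_le:
  assumes "J \<subseteq> {..<G * q}"
  shows "(\<Sum>j\<in>J. length (send P 1 i z j)) \<le> length z * G"
proof -
  have "(\<Sum>j\<in>J. length (send P 1 i z j)) \<le> (\<Sum>j\<in>J. if i = j mod q then length z else 0)"
    by (intro sum_mono) (simp add: bucketed_network_def)
  also have "\<dots> = length z * card {j \<in> J. i = j mod q}"
    using assms finite_subset by (subst sum.inter_filter[symmetric]) auto
  also have "card {j \<in> J. i = j mod q} = card ((\<lambda>j. j div q) ` {j \<in> J. i = j mod q})"
    by (rule card_image[symmetric]) (auto intro!: inj_onI, metis div_mult_mod_eq)
  also have "\<dots> \<le> card {..<G}"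
    using assms index_split(1) by (intro card_mono) auto
  finally show ?thesis by simp
qed

text \<open>Self-messages are free on both sides: inside the block of \<open>i\<close> only
  \<open>i\<close> itself has residue \<open>i mod q\<close>, so leaving out \<open>i\<close>
  matches leaving out \<open>i mod q\<close>.\<close>

lemma send_group_le:
  assumes "t < r" "i < G * q"
  shows "(\<Sum>j\<in>{..<G * q} - {i}. length (send P (t + 2) i (memory P x (t + 2) i) j))
    \<le> (\<Sum>j\<in>{..<q} - {i mod q}. length (send N t (i mod q) (memory N (y (i div q)) t (i mod q)) j))"
proof -
  define f where "f j = length (send N t (i mod q) (memory N (y (i div q)) t (i mod q)) j)" for j
  have "(\<Sum>j\<in>{..<G * q} - {i}. length (send P (t + 2) i (memory P x (t + 2) i) j)) =
      (\<Sum>j\<in>{..<G * q} - {i}. if j div q = i div q then f (j mod q) else 0)"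
    unfolding memory_group'[OF less_imp_le[OF assms(1)] assms(2)] f_def using assms(1)
    by (intro sum.cong) (auto simp: bucketed_network_def)
  also have "\<dots> \<le> sum f ({..<q} - {i mod q})"
  proof (rule sum_in_block_le)
    fix j assume j: "j \<in> {..<G * q} - {i}" "j div q = i div q"
    then have "j mod q \<noteq> i mod q" by (metis DiffD2 div_mult_mod_eq singletonI)
    then show "j mod q \<in> {..<q} - {i mod q}" using j index_split(2)[of j] by simp
  qed auto
  finally show ?thesis by (simp add: f_def)
qed

lemma send_gather_le:
  assumes "finite J"
  shows "(\<Sum>j\<in>J. length (send P (r + 2) i z j)) \<le> length z"
proof -
  have "length (send P (r + 2) i z j) = (if j = 0 then length z else 0)" for j
    by (simp add: bucketed_network_def)
  then show ?thesis using assms by simp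
qed

text \<open>Postprocessing only involves a message of machine 0 to itself, which is not
  charged.\<close>

lemma send_final_eq: "(\<Sum>j\<in>J - {i}. length (send P (r + 3) i z j)) = 0"
  by (rule sum.neutral) (auto simp: bucketed_network_def)

lemma total_memory_group:
  assumes "t \<le> r" "\<And>g. g < G \<Longrightarrow> (\<Sum>i<q. length (memory N (y g) t i)) \<le> T"
  shows "(\<Sum>i<G * q. length (memory P x (t + 2) i)) \<le> G * T"
proof -
  have "(\<Sum>i<G * q. length (memory P x (t + 2) i)) = (\<Sum>g<G. \<Sum>i<q. length (memory N (y g) t i))"
    unfolding sum_blocks using assms(1) by (intro sum.cong refl) (simp only: memory_group lessThan_iff)
  also have "\<dots> \<le> (\<Sum>g<G. T)" using assms(2) by (intro sum_mono) simp
  finally show ?thesis by simp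
qed

lemma memory_gather_encode:
  assumes "\<And>g i. g < G \<Longrightarrow> i < q \<Longrightarrow> memory N (y g) r i = encode c (D' g i)"
  shows "memory P x (r + 3) 0 = encode c (concat (map (\<lambda>g. concat (map (D' g) [0..<q])) [0..<G]))"
proof -
  have "concat (map (\<lambda>i. memory P x (r + 2) (g * q + i)) [0..<q]) = encode c (concat (map (D' g) [0..<q]))"
    if "g < G" for g
    unfolding encode_concat map_map using that memory_group[of r g] assms[of g]
    by (intro arg_cong[of _ _ concat] map_cong) (auto simp del: memory.simps)
  then show ?thesis
    unfolding memory_gather concat_map_blocks encode_concat[of _ "map _ [0..<G]"] map_map
    by (simp only: refl if_True comp_def) (intro arg_cong[of _ _ concat] map_cong, auto simp del: memory.simps)
qed

text \<open>Each premise on \<open>S'\<close> pays for one phase: \<open>S\<close> for the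
  simulation, 3 for the machine holding a single edge, \<open>3 * G\<close> for sending its copies,
  and the sum of the matching sizes for gathering. The bound on \<open>card E\<close> covers the
  total space before the simulation starts.\<close>

theorem bucketed_run_correct:
  assumes runs: "\<And>g. g < G \<Longrightarrow> space_bounded B N (y g) r S T"
    and outputs: "\<And>g i. g < G \<Longrightarrow> i < q \<Longrightarrow> memory N (y g) r i = encode c (D' g i)"
    and D': "\<And>g. g < G \<Longrightarrow> distributed q (D' g) (M g)"
    and M: "\<And>g. g < G \<Longrightarrow> M g \<subseteq> E"
    and out: "out (encode c (concat (map (\<lambda>g. concat (map (D' g) [0..<q])) [0..<G]))) = encode c ms"
    and ms: "distinct ms" "set ms \<subseteq> (\<Union>g<G. M g)"
    and words: "\<And>e. e \<in> E \<Longrightarrow> {Min e, Max e, c e} \<subseteq> {..<B}"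
    and input: "\<And>i. i < p \<Longrightarrow> length (encode c (D i)) \<le> S'"
    and S': "S \<le> S'" "E \<noteq> {} \<Longrightarrow> 3 \<le> S'" "E \<noteq> {} \<Longrightarrow> 3 * G \<le> S'"
      "3 * (\<Sum>g<G. card (M g)) \<le> S'"
    and T: "3 * card E \<le> T"
  shows "space_bounded B P x (r + 4) S' (G * T) \<and>
    (\<forall>j<G * q. memory P x (r + 4) j = (if j = 0 then encode c ms else []))"
proof -
  define all where "all = concat (map (\<lambda>g. concat (map (D' g) [0..<q])) [0..<G])"
  have gather: "memory P x (r + 3) j = (if j = 0 then encode c all else [])" for j
  proof (cases "j = 0")
    case True
    then show ?thesis using memory_gather_encode[OF outputs] unfolding all_def by simp
  next
    case False
    then show ?thesis unfolding memory_gather by simp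
  qed
  have set_all: "set all = (\<Union>g<G. M g)"
    using D' by (auto simp: all_def distributed_def)
  have final: "memory P x (r + 4) j = (if j = 0 then encode c ms else [])" if "j < G * q" for j
    unfolding memory_final[OF that] gather using out by (simp add: all_def)
  have "length (concat (map (D' g) [0..<q])) = card (M g)" if "g < G" for g
    using D'[OF that] by (auto simp: distributed_def distinct_card[symmetric])
  then have len_all: "length all = (\<Sum>g<G. card (M g))"
    unfolding all_def sum_length_concat[symmetric] by simp
  have set_E: "(\<Union>g<G. M g) \<subseteq> E" using M by blast
  have finE: "finite E" using D by (auto simp: distributed_def)
  have encode_words: "set (encode c es) \<subseteq> {..<B}" if "set es \<subseteq> E" for es
    using words that unfolding set_encode by blast
  \<comment> \<open>\<open>ms\<close> is distinct and uses only gathered edges, so the output needs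
    no more room than machine 0 has already used.\<close>
  have len_ms: "length ms \<le> length all"
    by (metis card_length card_mono distinct_card finite_set le_trans ms set_all)
  have len_ms': "length ms \<le> card E"
    using ms set_E finE by (metis card_mono distinct_card order_trans)
  have TG: "T \<le> G * T" using G_pos by simp
  have times: "t = 0 \<or> t = 1 \<or> (\<exists>t'\<le>r. t = t' + 2) \<or> t = r + 3 \<or> t = r + 4" if "t \<le> r + 4" for t
  proof (cases "t \<ge> 2 \<and> t \<le> r + 2")
    case True
    then have "t = (t - 2) + 2" "t - 2 \<le> r" by auto
    then show ?thesis by blast
  qed (use that in linarith)
  note runs = runs[unfolded space_bounded_def]
  have local_space: "length (memory P x t i) \<le> S' \<and> set (memory P x t i) \<subseteq> {..<B}"
    if t: "t \<le> r + 4" and i: "i < G * q" for t i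
    using times[OF t]
  proof (elim disjE exE conjE)
    assume t: "t = 0"
    show ?thesis
      unfolding t memory.simps(1) initial_memory_def using input encode_words input_subset by auto
  next
    assume t: "t = 1"
    show ?thesis
      using memory_1_length[OF i] S'(2) encode_words[OF piece_subset[of i]]
      unfolding t memory_1[OF i] by (auto split: if_splits)
  next
    fix t' assume "t' \<le> r" "t = t' + 2"
    then show ?thesis
      using runs[of "i div q"] index_split[OF i] S'(1) memory_group'[OF _ i, of t'] by fastforce
  next
    assume t: "t = r + 3"
    show ?thesis
      unfolding t gather using len_all S'(4) encode_words[of all] set_all set_E by simp
  next
    assume t: "t = r + 4"
    show ?thesis
      unfolding t final[OF i] using len_ms len_all S'(4) encode_words[of ms] ms(2) set_E by simp
  qed
  have total_space: "(\<Sum>i<G * q. length (memory P x t i)) \<le> G * T" if t: "t \<le> r + 4" for t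
    using times[OF t]
  proof (elim disjE exE conjE)
    assume t: "t = 0"
    show ?thesis unfolding t total_memory_0 using T TG by (rule le_trans)
  next
    assume t: "t = 1"
    show ?thesis unfolding t total_memory_1 using T TG by (rule le_trans)
  next
    fix t' assume "t' \<le> r" "t = t' + 2"
    then show ?thesis using runs total_memory_group[of t' T] by blast
  next
    assume t: "t = r + 3"
    have "(\<Sum>i<G * q. length (memory P x (r + 3) i)) \<le> length (memory P x (r + 3) 0)"
      by (simp add: gather if_distrib sum.delta cong: if_cong)
    also have "\<dots> = (\<Sum>i<G * q. length (memory P x (r + 2) i))"
      unfolding memory_gather sum_length_concat by (simp only: refl if_True)
    also have "\<dots> \<le> G * T" using runs total_memory_group[of r T] by blast
    finally show ?thesis unfolding t .
  next
    assume t: "t = r + 4"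
    have "(\<Sum>i<G * q. length (memory P x (r + 4) i)) = (\<Sum>i<G * q. if i = 0 then 3 * length ms else 0)"
      using final by (intro sum.cong) auto
    also have "\<dots> \<le> 3 * length ms" by (simp add: sum.delta)
    finally have "(\<Sum>i<G * q. length (memory P x (r + 4) i)) \<le> 3 * length ms" .
    then show ?thesis unfolding t using len_ms' T TG by linarith
  qed
  have sent: "(\<Sum>j\<in>{..<G * q} - {i}. length (send P t i (memory P x t i) j)) \<le> S'"
    if t: "t < r + 4" and i: "i < G * q" for t i
  proof -
    consider "t = 0" | "t = 1" | t' where "t' < r" "t = t' + 2" | "t = r + 2" | "t = r + 3"
      using times[of t] t by (metis add_right_cancel le_neq_implies_less less_imp_le nat_less_le)
    then show ?thesis
    proof cases
      case 1
      have "(\<Sum>j\<in>{..<G * q} - {i}. length (send P 0 i (x i) j)) \<le> length (x i)"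
        using i by (intro send_0_le) auto
      also have "\<dots> \<le> S'" using local_space[of 0 i] i by simp
      finally show ?thesis using 1 by simp
    next
      case 2
      have "(\<Sum>j\<in>{..<G * q} - {i}. length (send P 1 i (memory P x 1 i) j)) \<le> length (memory P x 1 i) * G"
        by (rule send_1_le) auto
      also have "\<dots> \<le> (if E = {} then 0 else 3) * G"
        using memory_1_length[OF i] by (rule mult_le_mono1)
      also have "\<dots> \<le> S'" using S'(3) by simp
      finally show ?thesis unfolding 2 .
    next
      case 3
      have "(\<Sum>j\<in>{..<q} - {i mod q}. length (send N t' (i mod q) (memory N (y (i div q)) t' (i mod q)) j)) \<le> S"
        using runs[of "i div q"] index_split[OF i] 3 by blast
      then show ?thesis using send_group_le[OF 3(1) i] S'(1) unfolding 3 by linarith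
    next
      case 4
      have "(\<Sum>j\<in>{..<G * q} - {i}. length (send P (r + 2) i (memory P x (r + 2) i) j))
          \<le> length (memory P x (r + 2) i)"
        by (rule send_gather_le) simp
      then show ?thesis using local_space[of "r + 2" i] i unfolding 4 by linarith
    next
      case 5
      then show ?thesis by (simp only: send_final_eq le0)
    qed
  qed
  have "space_bounded B P x (r + 4) S' (G * T)"
    unfolding space_bounded_def machines_P using local_space total_space sent by blast
  then show ?thesis using final by blast
qed

end

section \<open>The reduction\<close>

text \<open>The pairwise form passes to subgraphs, where the extremal weights may change.\<close>

lemma weight_ratio_le_iff:
  assumes "finite E" "E \<noteq> {}" "\<And>e. e \<in> E \<Longrightarrow> 0 < w e"
  shows "weight_ratio E w \<le> W \<longleftrightarrow> (\<forall>e\<in>E. \<forall>e'\<in>E. w e \<le> W * w e')"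
proof -
  have "Max (w ` E) \<in> w ` E" "Min (w ` E) \<in> w ` E"
    using assms(1,2) by (auto intro: Max_in Min_in)
  then obtain a b where ab: "a \<in> E" "b \<in> E" "Max (w ` E) = w a" "Min (w ` E) = w b" by auto
  have bounds: "w e \<le> w a" "w b \<le> w e" if "e \<in> E" for e
    using that assms(1) by (auto simp: ab(3,4)[symmetric])
  have "weight_ratio E w \<le> W \<longleftrightarrow> w a \<le> W * w b"
    using assms(3)[OF ab(2)] by (simp add: weight_ratio_def ab pos_divide_le_eq)
  also have "\<dots> \<longleftrightarrow> (\<forall>e\<in>E. \<forall>e'\<in>E. w e \<le> W * w e')"
  proof (intro iffI ballI)
    fix e e' assume le: "w a \<le> W * w b" and e: "e \<in> E" "e' \<in> E"
    have "0 < W * w b" using le assms(3)[OF ab(1)] by linarith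
    then have "0 < W" using assms(3)[OF ab(2)] by (simp add: zero_less_mult_iff)
    have "w e \<le> W * w b" using bounds(1)[OF e(1)] le by simp
    also have "\<dots> \<le> W * w e'" using bounds(2)[OF e(2)] \<open>0 < W\<close> by simp
    finally show "w e \<le> W * w e'" .
  qed (use ab in blast)
  finally show ?thesis .
qed

text \<open>The old ratio \<open>W\<close> serves to place all edges of a group on one level; the
  number of classes in a level then gives the new ratio.\<close>

lemma instance_graph_group:
  assumes "0 < \<epsilon>" "\<epsilon> < 1" "0 < K" "1 \<le> W"
    and inst: "instance_graph dec n m W B E c"
    and \<Lambda>: "\<Lambda> = nat \<lfloor>log (1 / \<epsilon>) W / K\<rfloor> + 3"
  shows "instance_graph dec n m ((1 / \<epsilon>) ^ K) B {e \<in> E. in_group \<epsilon> K \<Lambda> g (dec (c e))} c"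
proof -
  define E' where "E' = {e \<in> E. in_group \<epsilon> K \<Lambda> g (dec (c e))}"
  have sub: "E' \<subseteq> E" by (auto simp: E'_def)
  have E: "simple_graph n E" "card E \<le> m" "\<And>e. e \<in> E \<Longrightarrow> c e < B \<and> 0 < dec (c e)"
    using inst by (auto simp: instance_graph_def)
  have fin: "finite E" using E(1) by (rule simple_graph_finite)
  have ratio: "dec (c e) \<le> W * dec (c e')" if "e \<in> E" "e' \<in> E" for e e'
    using that inst E(3) weight_ratio_le_iff[OF fin, of "dec \<circ> c" W]
    by (auto simp: instance_graph_def)
  have "dec (c e) \<le> (1 / \<epsilon>) ^ K * dec (c e')" if e: "e \<in> E'" "e' \<in> E'" for e e'
  proof (rule same_level_ratio[OF assms(1,2) _ _ assms(3), where s = "g mod K"])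
    show "shifted_level \<epsilon> K (g mod K) (dec (c e)) = shifted_level \<epsilon> K (g mod K) (dec (c e'))"
      using e E(3) ratio
      by (intro in_group_same_level[OF assms(1,2) _ _ assms(3,4) _ _ \<Lambda>]) (auto simp: E'_def)
  qed (use e E(3) in \<open>auto simp: E'_def in_group_def\<close>)
  then have "weight_ratio E' (dec \<circ> c) \<le> (1 / \<epsilon>) ^ K" if "E' \<noteq> {}"
    using that sub E(3) finite_subset[OF sub fin] by (subst weight_ratio_le_iff) auto
  then show ?thesis
    using simple_graph_subset[OF E(1) sub] card_mono[OF fin sub] E(2,3) sub
    unfolding instance_graph_def E'_def[symmetric] by (meson le_trans subsetD)
qed

lemma instance_graph_words:
  assumes "instance_graph dec n m W B E c" "n \<le> B" "e \<in> E"
  shows "{Min e, Max e, c e} \<subseteq> {..<B}"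
proof -
  obtain u v where "e = {u, v}" "u < v" "v < n"
    using assms simple_graph_edgeE by (metis instance_graph_def)
  then show ?thesis using assms by (auto simp: instance_graph_def min_def max_def)
qed

text \<open>A machine knows neither the graph nor \<open>c\<close>, only words. The choice therefore
  ranges over all decodings of \<open>z\<close>, which agree by injectivity of the encoding.\<close>

definition best_matching :: "(nat \<Rightarrow> real) \<Rightarrow> nat list \<Rightarrow> nat list" where
  "best_matching dec z = (SOME z'. \<exists>c es ms. z = encode c es \<and> (\<forall>e\<in>set es. card e = 2) \<and>
     distinct ms \<and> is_max_weight_matching (set es) (dec \<circ> c) (set ms) \<and> z' = encode c ms)"

lemma best_matching_encode:
  assumes "\<And>e. e \<in> set es \<Longrightarrow> card e = 2"
  obtains ms where "distinct ms" "is_max_weight_matching (set es) (dec \<circ> c) (set ms)"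
    "best_matching dec (encode c es) = encode c ms"
proof -
  obtain M where M: "is_max_weight_matching (set es) (dec \<circ> c) M"
    using max_weight_matching_exists[of "set es"] by auto
  then have "M \<subseteq> set es" by (auto simp: is_max_weight_matching_def is_matching_def)
  then obtain l where "set l = M" "distinct l"
    using finite_distinct_list finite_subset by (metis finite_set)
  then have "\<exists>z'. \<exists>c' es' ms. encode c es = encode c' es' \<and> (\<forall>e\<in>set es'. card e = 2) \<and>
      distinct ms \<and> is_max_weight_matching (set es') (dec \<circ> c') (set ms) \<and> z' = encode c' ms"
    using M assms by blast
  from someI_ex[OF this, folded best_matching_def]
  obtain c' es' ms where *: "encode c es = encode c' es'" "\<forall>e\<in>set es'. card e = 2" "distinct ms"
      "is_max_weight_matching (set es') (dec \<circ> c') (set ms)"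
      "best_matching dec (encode c es) = encode c' ms"
    by blast
  have eq: "es = es'" "\<And>e. e \<in> set es \<Longrightarrow> c e = c' e"
    using encode_inject[OF *(1)] assms *(2) by auto
  have sum_eq: "sum (dec \<circ> c) M' = sum (dec \<circ> c') M'" if "is_matching (set es) M'" for M'
    using that eq(2) by (intro sum.cong) (auto simp: is_matching_def)
  have ms: "is_matching (set es) (set ms)"
    using *(4) eq(1) by (simp add: is_max_weight_matching_def)
  show ?thesis
  proof (rule that[OF *(3)])
    show "is_max_weight_matching (set es) (dec \<circ> c) (set ms)"
      using *(4) sum_eq ms eq(1) by (simp add: is_max_weight_matching_def)
    show "best_matching dec (encode c es) = encode c ms"
      using *(5) eq(2) ms encode_cong[of ms c c'] by (simp add: is_matching_def subset_iff)
  qed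
qed

text \<open>Together with the lower bound on total space this makes \<open>T\<close> a valid number
  of slots per machine.\<close>

lemma distributed_length_le:
  assumes "distributed p D E" "i < p"
  shows "length (D i) \<le> card E"
proof -
  have "length (D i) \<le> (\<Sum>i<p. length (D i))"
    using assms(2) by (intro member_le_sum) auto
  also have "\<dots> = card E"
    using assms(1) unfolding sum_length_concat by (auto simp: distributed_def distinct_card[symmetric])
  finally show ?thesis .
qed

lemma mpc_mwm_algorithm_machines_ge:
  assumes "mpc_mwm_algorithm dec \<alpha> A R S T" "valid_params W \<epsilon>" "n \<le> B"
  shows "p \<le> machines (A n m W \<epsilon> B p)"
  using conjunct1[OF assms(1)[unfolded mpc_mwm_algorithm_def]] assms(2,3) by blast

lemma mpc_mwm_algorithm_run:
  assumes "mpc_mwm_algorithm dec \<alpha> A R S T"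
    and "valid_params W \<epsilon>" "n \<le> B" "instance_graph dec n m W B E c"
  shows "E \<noteq> {} \<Longrightarrow> 3 \<le> S n m W \<epsilon>"
    and "distributed p D E \<Longrightarrow> (\<And>i. i < p \<Longrightarrow> length (encode c (D i)) \<le> S n m W \<epsilon>) \<Longrightarrow>
      space_bounded B (A n m W \<epsilon> B p) (initial_memory p c D) (R n m W \<epsilon>) (S n m W \<epsilon>) (T n m W \<epsilon>) \<and>
      (\<exists>D' M. distributed (machines (A n m W \<epsilon> B p)) D' M \<and>
        (\<forall>i<machines (A n m W \<epsilon> B p).
          memory (A n m W \<epsilon> B p) (initial_memory p c D) (R n m W \<epsilon>) i = encode c (D' i)) \<and>
        approx_max_weight_matching (\<alpha> \<epsilon>) E (dec \<circ> c) M)"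
proof -
  note spec = conjunct2[OF assms(1)[unfolded mpc_mwm_algorithm_def Let_def], rule_format, OF assms(2-4)]
  show "E \<noteq> {} \<Longrightarrow> 3 \<le> S n m W \<epsilon>" using spec by (rule conjunct1[THEN mp])
  show "space_bounded B (A n m W \<epsilon> B p) (initial_memory p c D) (R n m W \<epsilon>) (S n m W \<epsilon>) (T n m W \<epsilon>) \<and>
      (\<exists>D' M. distributed (machines (A n m W \<epsilon> B p)) D' M \<and>
        (\<forall>i<machines (A n m W \<epsilon> B p).
          memory (A n m W \<epsilon> B p) (initial_memory p c D) (R n m W \<epsilon>) i = encode c (D' i)) \<and>
        approx_max_weight_matching (\<alpha> \<epsilon>) E (dec \<circ> c) M)"
    if "distributed p D E" "\<And>i. i < p \<Longrightarrow> length (encode c (D i)) \<le> S n m W \<epsilon>"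
    by (rule conjunct2[OF spec, rule_format]) (use that in auto)
qed

text \<open>Giving all edges of an instance the same weight code yields an instance of weight ratio 1, one
  edge per machine: this bounds the resources from below, independently of the weights.\<close>

lemma mpc_mwm_algorithm_lower_bounds:
  assumes A: "mpc_mwm_algorithm dec \<alpha> A R S T"
    and V: "valid_params V \<epsilon>" and B: "n \<le> B" and inst: "instance_graph dec n m W B E c"
  shows "3 * card E \<le> T n m V \<epsilon>" "E \<noteq> {} \<Longrightarrow> 3 \<le> S n m V \<epsilon>"
    and "R n m V \<epsilon> = 0 \<Longrightarrow> is_matching E E"
proof -
  have "3 * card E \<le> T n m V \<epsilon> \<and> 3 \<le> S n m V \<epsilon> \<and> (R n m V \<epsilon> = 0 \<longrightarrow> is_matching E E)"
    if ne: "E \<noteq> {}"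
  proof -
    have E: "simple_graph n E" "card E \<le> m" "\<And>e. e \<in> E \<Longrightarrow> c e < B \<and> 0 < dec (c e)"
      using inst by (auto simp: instance_graph_def)
    have fin: "finite E" using E(1) by (rule simple_graph_finite)
    obtain a where a: "a \<in> E" using ne by auto
    \<comment> \<open>The code is borrowed from an edge because \<open>dec\<close> is arbitrary:
      only codes that occur are known to denote positive weights.\<close>
    define c' where "c' = (\<lambda>_::edge. c a)"
    have inst': "instance_graph dec n m V B E c'"
      using E a ne fin V
      by (auto simp: instance_graph_def c'_def weight_ratio_def valid_params_def comp_def image_constant_conv)
    obtain es where es: "set es = E" "distinct es" using finite_distinct_list[OF fin] by blast
    define p where "p = length es"
    have p: "p = card E" using es by (simp add: p_def distinct_card[symmetric])
    define D where "D i = [es ! i]" for i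
    have "concat (map D [0..<p]) = es"
      unfolding D_def p_def by (simp add: map_nth concat_map_singleton)
    then have D: "distributed p D E" using es by (simp add: distributed_def)
    have S3: "3 \<le> S n m V \<epsilon>"
      using mpc_mwm_algorithm_run(1)[OF A V B inst' ne] .
    then have len: "length (encode c' (D i)) \<le> S n m V \<epsilon>" if "i < p" for i by (simp add: D_def)
    define N where "N = A n m V \<epsilon> B p"
    define x where "x = initial_memory p c' D"
    have pN: "p \<le> machines N"
      using mpc_mwm_algorithm_machines_ge[OF A V B] by (simp add: N_def)
    have run: "space_bounded B N x (R n m V \<epsilon>) (S n m V \<epsilon>) (T n m V \<epsilon>)"
      "\<exists>D' M. distributed (machines N) D' M \<and>
        (\<forall>i<machines N. memory N x (R n m V \<epsilon>) i = encode c' (D' i)) \<and>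
        approx_max_weight_matching (\<alpha> \<epsilon>) E (dec \<circ> c') M"
      using mpc_mwm_algorithm_run(2)[OF A V B inst' D len, folded N_def x_def] by blast+
    have "(\<Sum>i<machines N. length (x i)) = (\<Sum>i<p. length (x i))"
      using pN by (intro sum.mono_neutral_right) (auto simp: x_def initial_memory_def)
    also have "\<dots> = 3 * card E" by (simp add: x_def initial_memory_def D_def p)
    finally have total: "(\<Sum>i<machines N. length (memory N x 0 i)) = 3 * card E" by simp
    then have "3 * card E \<le> T n m V \<epsilon>" using run(1) unfolding space_bounded_def by (metis le0)
    moreover have "is_matching E E" if R: "R n m V \<epsilon> = 0"
    proof -
      obtain D' M where D': "distributed (machines N) D' M"
        "\<And>i. i < machines N \<Longrightarrow> memory N x 0 i = encode c' (D' i)"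
        and M: "is_matching E M"
        using run(2) unfolding R approx_max_weight_matching_def by blast
      \<comment> \<open>Without rounds the final memories are the initial ones. Counting words gives
        \<open>M\<close> as many edges as \<open>E\<close>, so the input itself is the
        matching.\<close>
      have "3 * card E = (\<Sum>i<machines N. 3 * length (D' i))"
        unfolding total[symmetric] using D'(2) by (intro sum.cong) (auto simp del: memory.simps)
      also have "\<dots> = 3 * card M"
        unfolding sum_distrib_left[symmetric] sum_length_concat
        using D'(1) by (auto simp: distributed_def distinct_card[symmetric])
      finally have "M = E"
        using M fin by (intro card_subset_eq) (auto simp: is_matching_def)
      then show ?thesis using M by simp
    qed
    ultimately show ?thesis using S3 by blast
  qed
  moreover have "is_matching {} {}" by (simp add: is_matching_def)
  ultimately show "3 * card E \<le> T n m V \<epsilon>" "E \<noteq> {} \<Longrightarrow> 3 \<le> S n m V \<epsilon>"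
    "R n m V \<epsilon> = 0 \<Longrightarrow> is_matching E E"
    by (cases "E = {}"; simp)+
qed

section \<open>Parameters of the reduction and their estimates\<close>

definition shift_count :: "real \<Rightarrow> nat" where
  "shift_count \<epsilon> = nat \<lceil>1 / \<epsilon>\<rceil>"

text \<open>The function \<open>f\<close> of the theorem. It bounds the ratio within a level and is
  also the threshold for \<open>W\<close> above which \<open>shift_count\<close> is at most the
  logarithm of \<open>W\<close>.\<close>

definition group_ratio :: "real \<Rightarrow> real" where
  "group_ratio \<epsilon> = (1 / \<epsilon>) ^ shift_count \<epsilon>"

definition level_count :: "real \<Rightarrow> real \<Rightarrow> nat" where
  "level_count \<epsilon> W = nat \<lfloor>log (1 / \<epsilon>) W / shift_count \<epsilon>\<rfloor> + 3"

definition group_count :: "real \<Rightarrow> real \<Rightarrow> nat" where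
  "group_count \<epsilon> W = shift_count \<epsilon> * level_count \<epsilon> W"

lemma shift_count_ge: "1 / \<epsilon> \<le> real (shift_count \<epsilon>)"
  unfolding shift_count_def by linarith

lemma shift_count_pos: "0 < \<epsilon> \<Longrightarrow> 0 < shift_count \<epsilon>"
  by (simp add: shift_count_def)

lemma group_count_pos: "0 < \<epsilon> \<Longrightarrow> 0 < group_count \<epsilon> W"
  by (simp add: group_count_def level_count_def shift_count_pos)

lemma group_ratio_gt_2:
  assumes "0 < \<epsilon>" "\<epsilon> < 1/2"
  shows "2 < group_ratio \<epsilon>"
proof -
  have gt: "2 < 1 / \<epsilon>" using assms by (simp add: field_simps)
  also have "\<dots> \<le> group_ratio \<epsilon>"
    unfolding group_ratio_def using shift_count_pos[OF assms(1)] gt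
    by (intro self_le_power) auto
  finally show ?thesis .
qed

text \<open>With \<open>K\<close> shifts and \<open>L\<close> the logarithm of \<open>W\<close>,
  rounding costs three extra levels per shift, in total L + 3 * K, and K \<le> L above the
  threshold. There \<open>max 2 W\<close> is just \<open>W\<close>.\<close>

lemma group_count_le:
  assumes "0 < \<epsilon>" "\<epsilon> < 1/2" "group_ratio \<epsilon> < W"
  shows "real (group_count \<epsilon> W) \<le> 4 * log (1 / \<epsilon>) (max 2 W)"
proof -
  define L where "L = log (1 / \<epsilon>) W"
  have W: "2 < W" using group_ratio_gt_2[OF assms(1,2)] assms(3) by simp
  have b: "1 < 1 / \<epsilon>" using assms by (simp add: field_simps)
  have K: "0 < shift_count \<epsilon>" using assms(1) by (rule shift_count_pos)
  have "(1 / \<epsilon>) powr shift_count \<epsilon> \<le> W"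
    using assms(1,3) by (simp add: group_ratio_def powr_realpow)
  then have LK: "real (shift_count \<epsilon>) \<le> L"
    unfolding L_def using b W by (subst le_log_iff) auto
  have "real (level_count \<epsilon> W) \<le> L / shift_count \<epsilon> + 3"
    unfolding level_count_def L_def[symmetric] using LK by simp
  then have "real (group_count \<epsilon> W) \<le> shift_count \<epsilon> * (L / shift_count \<epsilon> + 3)"
    unfolding group_count_def of_nat_mult using K by (intro mult_left_mono) auto
  also have "\<dots> = L + 3 * shift_count \<epsilon>" using K by (simp add: field_simps)
  also have "\<dots> \<le> 4 * L" using LK by simp
  finally show ?thesis using W by (simp add: L_def max_def)
qed

text \<open>Lets the claimed bound absorb a plain \<open>T\<close> when no groups are formed. It
  rests on ln (1/\<epsilon>) \<le> 1/\<epsilon> and ln 2 \<ge> 1/2; \<open>max 2 W\<close> keeps the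
  logarithm away from 0 at W = 1.\<close>

lemma log_over_eps_ge:
  assumes "0 < \<epsilon>" "\<epsilon> < 1/2"
  shows "1 \<le> 12 * (log (1 / \<epsilon>) (max 2 W) / \<epsilon>)" "0 \<le> log (1 / \<epsilon>) (max 2 W)"
proof -
  have b: "1 < 1 / \<epsilon>" using assms by (simp add: field_simps)
  have "0 < ln (1 / \<epsilon>)" using b by (rule ln_gt_zero)
  have "ln (1 / \<epsilon>) \<le> 1 / \<epsilon>" using ln_bound[of "1 / \<epsilon>"] assms(1) by simp
  moreover have ln2: "1 / 2 \<le> ln (max 2 W)"
    using ln_le_minus_one[of "1 / 2"] ln_mono[of 2 "max 2 W"] by (simp add: ln_div del: ln_le_cancel_iff)
  moreover have "1 * (1 / \<epsilon>) \<le> 12 * ln (max 2 W) * (1 / \<epsilon>)"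
    using ln2 assms(1) by (intro mult_right_mono) auto
  ultimately have "ln (1 / \<epsilon>) \<le> 12 * ln (max 2 W) * (1 / \<epsilon>)" by linarith
  then show "1 \<le> 12 * (log (1 / \<epsilon>) (max 2 W) / \<epsilon>)"
    using \<open>0 < ln (1 / \<epsilon>)\<close> assms(1) by (simp add: log_def field_simps)
  show "0 \<le> log (1 / \<epsilon>) (max 2 W)"
    using \<open>0 < ln (1 / \<epsilon>)\<close> ln2 by (simp add: log_def)
qed

context
  fixes dec :: "nat \<Rightarrow> real" and A :: mpc_algorithm and R S T :: resource
begin

text \<open>Without rounds or without space every instance graph must be a matching already; this case is
  separate because the reduction needs \<open>O(1)\<close> additional rounds.\<close>

definition trivial_params :: "nat \<Rightarrow> nat \<Rightarrow> real \<Rightarrow> bool" where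
  "trivial_params n m \<epsilon> \<longleftrightarrow> R n m (group_ratio \<epsilon>) \<epsilon> = 0 \<or> T n m (group_ratio \<epsilon>) \<epsilon> = 0"

text \<open>The slot number \<open>h\<close> must bound the edges on one machine. \<open>T\<close>
  does, since the given algorithm has to store the whole input, and the number of machines may be
  polynomial in it.\<close>

definition reduction :: mpc_algorithm where
  "reduction n m W \<epsilon> B p =
    (let V = group_ratio \<epsilon>; h = T n m V \<epsilon> in
     if W \<le> V then A n m V \<epsilon> B p
     else if trivial_params n m \<epsilon> then \<lparr>machines = p, send = (\<lambda>_ _ _ _. [])\<rparr>
     else bucketed_network (\<lambda>g a. in_group \<epsilon> (shift_count \<epsilon>) (level_count \<epsilon> W) g (dec a))
       (best_matching dec) (group_count \<epsilon> W) h (R n m V \<epsilon>) (A n m V \<epsilon> B (p * h)))"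

text \<open>The four extra rounds are two for distributing, one for gathering and one for
  postprocessing.\<close>

definition reduction_rounds :: resource where
  "reduction_rounds n m W \<epsilon> =
    (let V = group_ratio \<epsilon> in
     if W \<le> V then R n m V \<epsilon> else if trivial_params n m \<epsilon> then 0 else R n m V \<epsilon> + 4)"

text \<open>The added term is room for one matching per group, at most \<open>n\<close> edges of
  three words each.\<close>

definition reduction_space :: resource where
  "reduction_space n m W \<epsilon> =
    (let V = group_ratio \<epsilon> in
     if W \<le> V \<or> trivial_params n m \<epsilon> then S n m V \<epsilon>
     else S n m V \<epsilon> + 3 * (n * group_count \<epsilon> W))"

definition reduction_total :: resource where
  "reduction_total n m W \<epsilon> =
    (let V = group_ratio \<epsilon> in
     if W \<le> V \<or> trivial_params n m \<epsilon> then T n m V \<epsilon> else group_count \<epsilon> W * T n m V \<epsilon>)"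

text \<open>The 12 is three words per edge times the 4 of \<open>group_count_le\<close>. It also
  covers R + 4 \<le> 5 * R for R \<ge> 1, and the comparison of \<open>T\<close> alone with the
  bound on total space.\<close>

lemma reduction_bounds:
  assumes "valid_params W \<epsilon>"
  shows "real (reduction_rounds n m W \<epsilon>) \<le> 12 * real (R n m (group_ratio \<epsilon>) \<epsilon>)"
    and "real (reduction_space n m W \<epsilon>) \<le>
      12 * (real (S n m (group_ratio \<epsilon>) \<epsilon>) + real n * log (1 / \<epsilon>) (max 2 W))"
    and "real (reduction_total n m W \<epsilon>) \<le>
      12 * (real (T n m (group_ratio \<epsilon>) \<epsilon>) * log (1 / \<epsilon>) (max 2 W) / \<epsilon>)"
proof -
  have \<epsilon>: "0 < \<epsilon>" "\<epsilon> < 1/2" using assms by (auto simp: valid_params_def)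
  define V L where "V = group_ratio \<epsilon>" and "L = log (1 / \<epsilon>) (max 2 W)"
  have L: "1 \<le> 12 * (L / \<epsilon>)" "0 \<le> L" using log_over_eps_ge[OF \<epsilon>] by (auto simp: L_def)
  have G: "real (group_count \<epsilon> W) \<le> 4 * L" if "\<not> W \<le> V"
    using group_count_le[OF \<epsilon>] that by (simp add: V_def L_def)
  show "real (reduction_rounds n m W \<epsilon>) \<le> 12 * real (R n m (group_ratio \<epsilon>) \<epsilon>)"
    by (auto simp: reduction_rounds_def trivial_params_def Let_def)
  have "3 * (real n * real (group_count \<epsilon> W)) \<le> 12 * (real n * L)" if "\<not> W \<le> V"
    using mult_left_mono[OF G[OF that], of "real n"] by (simp add: algebra_simps)
  moreover have "real (reduction_space n m W \<epsilon>) \<le>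
      real (S n m V \<epsilon>) + (if W \<le> V then 0 else 3 * (real n * real (group_count \<epsilon> W)))"
    by (simp add: reduction_space_def Let_def V_def)
  moreover have "0 \<le> real n * L" using L(2) by simp
  ultimately have "real (reduction_space n m W \<epsilon>) \<le> 12 * (real (S n m V \<epsilon>) + real n * L)"
    unfolding distrib_left by (smt (verit) of_nat_0_le_iff)
  then show "real (reduction_space n m W \<epsilon>) \<le>
      12 * (real (S n m (group_ratio \<epsilon>) \<epsilon>) + real n * log (1 / \<epsilon>) (max 2 W))"
    by (simp add: V_def L_def)
  have "real (group_count \<epsilon> W) * real (T n m V \<epsilon>) \<le> 12 * (L / \<epsilon>) * real (T n m V \<epsilon>)"
    if "\<not> W \<le> V"
  proof (rule mult_right_mono)
    have "L \<le> L / \<epsilon>" using L(2) \<epsilon> by (simp add: field_simps mult_left_le)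
    then show "real (group_count \<epsilon> W) \<le> 12 * (L / \<epsilon>)" using G[OF that] L(2) by linarith
  qed simp
  moreover have "1 * real (T n m V \<epsilon>) \<le> 12 * (L / \<epsilon>) * real (T n m V \<epsilon>)"
    using L(1) by (rule mult_right_mono) simp
  ultimately have "real (reduction_total n m W \<epsilon>) \<le> 12 * (L / \<epsilon>) * real (T n m V \<epsilon>)"
    by (auto simp: reduction_total_def Let_def V_def[symmetric])
  then show "real (reduction_total n m W \<epsilon>) \<le>
      12 * (real (T n m (group_ratio \<epsilon>) \<epsilon>) * log (1 / \<epsilon>) (max 2 W) / \<epsilon>)"
    by (simp add: V_def L_def ac_simps)
qed

section \<open>Correctness of the reduction for a correct algorithm \<open>A\<close>\<close>

context
  assumes A: "mpc_mwm_algorithm dec (\<lambda>\<epsilon>. 1 + \<epsilon>) A R S T"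
begin

lemma valid_group_ratio: "valid_params W \<epsilon> \<Longrightarrow> valid_params (group_ratio \<epsilon>) \<epsilon>"
  using group_ratio_gt_2[of \<epsilon>] by (simp add: valid_params_def)

text \<open>\<open>A\<close> is started for \<open>p * h\<close> input machines, and both factors
  are at most the base \<open>X\<close>. This squares the base, hence \<open>2 * k\<close>; the
  \<open>G\<close> copies cost one more factor \<open>X\<close>.\<close>

lemma reduction_machines:
  "\<exists>k. \<forall>n m W \<epsilon> B p. valid_params W \<epsilon> \<longrightarrow> n \<le> B \<longrightarrow>
     p \<le> machines (reduction n m W \<epsilon> B p) \<and>
     machines (reduction n m W \<epsilon> B p) \<le> (2 + n + p + reduction_total n m W \<epsilon>) ^ k"
proof -
  obtain k where k: "\<And>n m W \<epsilon> B p. valid_params W \<epsilon> \<Longrightarrow> n \<le> B \<Longrightarrow>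
      p \<le> machines (A n m W \<epsilon> B p) \<and> machines (A n m W \<epsilon> B p) \<le> (2 + n + p + T n m W \<epsilon>) ^ k"
    using A unfolding mpc_mwm_algorithm_def by blast
  have "p \<le> machines (reduction n m W \<epsilon> B p) \<and>
      machines (reduction n m W \<epsilon> B p) \<le> (2 + n + p + reduction_total n m W \<epsilon>) ^ (2 * k + 1)"
    if W: "valid_params W \<epsilon>" and B: "n \<le> B" for n m W \<epsilon> B p
  proof -
    define V h X where "V = group_ratio \<epsilon>" and "h = T n m V \<epsilon>"
      and "X = 2 + n + p + reduction_total n m W \<epsilon>"
    have V: "valid_params V \<epsilon>" using valid_group_ratio[OF W] by (simp add: V_def)
    have X: "1 \<le> X" "p \<le> X" by (auto simp: X_def)
    have X_pow: "X ^ i \<le> X ^ (2 * k + 1)" if "i \<le> 2 * k + 1" for i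
      using that X(1) by (rule power_increasing)
    consider "W \<le> V" | "\<not> W \<le> V" "trivial_params n m \<epsilon>" | "\<not> W \<le> V" "\<not> trivial_params n m \<epsilon>"
      by blast
    then show ?thesis
    proof cases
      case 1
      then have "reduction n m W \<epsilon> B p = A n m V \<epsilon> B p" "X = 2 + n + p + T n m V \<epsilon>"
        by (auto simp: reduction_def reduction_total_def X_def Let_def V_def)
      then show ?thesis using k[OF V B, of p m] le_trans[OF _ X_pow[of k]] unfolding X_def[symmetric]
        by simp
    next
      case 2
      then have "machines (reduction n m W \<epsilon> B p) = p"
        by (simp add: reduction_def Let_def V_def[symmetric])
      moreover have "p \<le> X ^ (2 * k + 1)" using X(2) self_le_power[OF X(1)] by (rule le_trans) simp
      ultimately show ?thesis unfolding X_def[symmetric] by (simp only: order_refl)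
    next
      case 3
      define G where "G = group_count \<epsilon> W"
      have G: "0 < G" using W group_count_pos by (simp add: G_def valid_params_def)
      have h: "0 < h" using 3(2) by (simp add: trivial_params_def h_def V_def)
      have XGT: "X = 2 + n + p + G * h"
        using 3 by (simp add: X_def reduction_total_def Let_def V_def[symmetric] h_def G_def)
      have Gh: "G \<le> G * h" "h \<le> G * h" using G h by auto
      have mach: "machines (reduction n m W \<epsilon> B p) = G * machines (A n m V \<epsilon> B (p * h))"
        using 3 by (simp add: reduction_def Let_def V_def[symmetric] h_def G_def bucketed_network_def)
      have "p \<le> p * h" using h by simp
      also have "\<dots> \<le> machines (A n m V \<epsilon> B (p * h))" using k[OF V B] by blast
      also have "\<dots> \<le> G * machines (A n m V \<epsilon> B (p * h))" using G by simp
      finally have ge: "p \<le> machines (reduction n m W \<epsilon> B p)" unfolding mach .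
      have "2 + n + p * h + h \<le> X * X"
      proof -
        have hX: "h \<le> X" unfolding XGT using Gh(2) by (rule trans_le_add2)
        have "p * h \<le> p * X" using hX by (rule mult_le_mono2)
        moreover have "n * 1 \<le> n * X" using X(1) by (rule mult_le_mono2)
        moreover have "2 \<le> X" by (simp add: X_def)
        ultimately have "2 + n + p * h + h \<le> (2 + n) * X + p * X"
          using hX unfolding add_mult_distrib by linarith
        also have "\<dots> \<le> X * X" unfolding add_mult_distrib[symmetric] by (rule mult_le_mono1) (simp add: XGT)
        finally show ?thesis .
      qed
      then have "(2 + n + p * h + h) ^ k \<le> X ^ (2 * k)"
        using power_mono[of "2 + n + p * h + h" "X * X" k]
        by (simp add: power_mult power2_eq_square)
      then have "machines (A n m V \<epsilon> B (p * h)) \<le> X ^ (2 * k)"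
        using k[OF V B, of "p * h" m] unfolding h_def by (meson le_trans)
      moreover have "G \<le> X" unfolding XGT using Gh(1) by (rule trans_le_add2)
      ultimately have "machines (reduction n m W \<epsilon> B p) \<le> X * X ^ (2 * k)"
        unfolding mach by (intro mult_le_mono)
      then show ?thesis using ge unfolding X_def[symmetric] by simp
    qed
  qed
  then show ?thesis by blast
qed

text \<open>Space for distributing an edge comes from the lower bounds extracted from
  \<open>A\<close> and from the term \<open>n * G\<close>; space for gathering comes from the bound
  \<open>n\<close> on the size of a matching.\<close>

lemma reduction_run_bucketed:
  fixes W \<epsilon> :: real
  defines "V \<equiv> group_ratio \<epsilon>" and "G \<equiv> group_count \<epsilon> W"
  assumes W: "valid_params W \<epsilon>" and B: "n \<le> B" and inst: "instance_graph dec n m W B E c"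
    and h: "h = T n m V \<epsilon>" "0 < h"
    and S': "S' = S n m V \<epsilon> + 3 * (n * G)"
    and D: "distributed p D E" and len: "\<And>i. i < p \<Longrightarrow> length (encode c (D i)) \<le> S'"
    and N: "N = bucketed_network (\<lambda>g a. in_group \<epsilon> (shift_count \<epsilon>) (level_count \<epsilon> W) g (dec a))
       (best_matching dec) G h (R n m V \<epsilon>) (A n m V \<epsilon> B (p * h))"
  shows "space_bounded B N (initial_memory p c D) (R n m V \<epsilon> + 4) S' (G * h) \<and>
    (\<exists>D' M. distributed (machines N) D' M \<and>
      (\<forall>i<machines N. memory N (initial_memory p c D) (R n m V \<epsilon> + 4) i = encode c (D' i)) \<and>
      approx_max_weight_matching (1 + 16 * \<epsilon>) E (dec \<circ> c) M)"
proof -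
  define K \<Lambda> r NA sel where "K = shift_count \<epsilon>" and "\<Lambda> = level_count \<epsilon> W" and "r = R n m V \<epsilon>"
    and "NA = A n m V \<epsilon> B (p * h)" and "sel = (\<lambda>g a. in_group \<epsilon> K \<Lambda> g (dec a))"
  have \<epsilon>: "0 < \<epsilon>" "\<epsilon> < 1/2" "\<epsilon> < 1" and W1: "1 \<le> W" using W by (auto simp: valid_params_def)
  have V: "valid_params V \<epsilon>" using valid_group_ratio[OF W] by (simp add: V_def)
  have K: "0 < K" "1 / \<epsilon> \<le> real K"
    using shift_count_pos[OF \<epsilon>(1)] shift_count_ge by (auto simp: K_def)
  have G: "G = K * \<Lambda>" by (simp add: G_def group_count_def K_def \<Lambda>_def)
  have Gpos: "0 < G" using group_count_pos[OF \<epsilon>(1)] by (simp add: G_def)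
  have \<Lambda>: "0 < \<Lambda>" using Gpos G by simp
  have E: "simple_graph n E" "\<And>e. e \<in> E \<Longrightarrow> 0 < dec (c e)"
    using inst by (auto simp: instance_graph_def)
  note lower = mpc_mwm_algorithm_lower_bounds[OF A V B inst]
  have fit: "p * h \<le> machines NA"
    using mpc_mwm_algorithm_machines_ge[OF A V B] by (simp add: NA_def)
  interpret bucketed_run sel "best_matching dec" G h r p NA c D E
  proof
    show "p \<le> machines NA" using fit h(2) by (cases h) auto
    show "length (D i) \<le> h" if "i < p" for i
      using distributed_length_le[OF D that] lower(1) unfolding h(1) by linarith
  qed (use Gpos h(2) fit D in auto)
  define Eg where "Eg g = {e \<in> E. sel g (c e)}" for g
  have inst_g: "instance_graph dec n m V B (Eg g) c" for g
    using instance_graph_group[OF \<epsilon>(1,3) K(1) W1 inst, of \<Lambda>]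
    by (simp add: Eg_def sel_def \<Lambda>_def level_count_def K_def V_def group_ratio_def)
  \<comment> \<open>A slot holds at most one edge, so three words suffice; in the empty graph slots
    are empty whatever \<open>S\<close> is.\<close>
  have len_g: "length (encode c (group_input g i)) \<le> S n m V \<epsilon>" if "i < p * h" for g i
  proof (cases "E = {}")
    case False
    then have "length (piece i) \<le> 1" "3 \<le> S n m V \<epsilon>" using piece_cases[of i] lower(2) by auto
    moreover have "length (group_input g i) \<le> length (piece i)" by (simp add: group_input_def)
    ultimately show ?thesis unfolding length_encode by linarith
  qed (use piece_subset[OF that] in \<open>simp add: group_input_def\<close>)
  have dist_g: "distributed (p * h) (group_input g) (Eg g)" for g
    using distributed_group_input by (simp add: Eg_def)
  have runs: "space_bounded B NA (y g) r (S n m V \<epsilon>) h" for g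
    using mpc_mwm_algorithm_run(2)[OF A V B inst_g dist_g len_g] by (simp add: NA_def r_def h(1))
  have "\<forall>g. \<exists>D' M. distributed (machines NA) D' M \<and>
      (\<forall>i<machines NA. memory NA (y g) r i = encode c (D' i)) \<and>
      approx_max_weight_matching (1 + \<epsilon>) (Eg g) (dec \<circ> c) M"
    using mpc_mwm_algorithm_run(2)[OF A V B inst_g dist_g len_g] by (simp add: NA_def r_def)
  then obtain D' M where D': "\<And>g. distributed (machines NA) (D' g) (M g)"
    and outputs: "\<And>g i. i < machines NA \<Longrightarrow> memory NA (y g) r i = encode c (D' g i)"
    and approx: "\<And>g. approx_max_weight_matching (1 + \<epsilon>) (Eg g) (dec \<circ> c) (M g)"
    by metis
  have matching: "is_matching (Eg g) (M g)" for g
    using approx by (simp add: approx_max_weight_matching_def)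
  have M_E: "M g \<subseteq> E" for g
    using matching[of g] by (auto simp: is_matching_def Eg_def)
  have card_M: "card (M g) \<le> n" for g
    using matching_card_le[OF _ matching[of g]] simple_graph_subset[OF E(1)] by (auto simp: Eg_def)
  define all where "all = concat (map (\<lambda>g. concat (map (D' g) [0..<q])) [0..<G])"
  have set_all: "set all = (\<Union>g<G. M g)"
    using D' by (auto simp: all_def distributed_def)
  have "card e = 2" if "e \<in> set all" for e
    using that M_E simple_graph_card2[OF E(1)] unfolding set_all by blast
  then obtain ms where ms: "distinct ms" "is_max_weight_matching (set all) (dec \<circ> c) (set ms)"
    "best_matching dec (encode c all) = encode c ms"
    by (rule best_matching_encode)
  have ms_sub: "set ms \<subseteq> (\<Union>g<G. M g)"
    using ms(2) by (simp add: is_max_weight_matching_def is_matching_def set_all)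
  have n_pos: "0 < n" if "E \<noteq> {}"
    using that simple_graph_edgeE[OF E(1)] by (metis all_not_in_conv less_nat_zero_code not_gr_zero)
  have sum_card: "(\<Sum>g<G. card (M g)) \<le> n * G"
    using sum_bounded_above[of "{..<G}" "\<lambda>g. card (M g)" n] card_M by (simp add: mult.commute)
  have run: "space_bounded B P x (r + 4) S' (G * h) \<and>
    (\<forall>j<G * q. memory P x (r + 4) j = (if j = 0 then encode c ms else []))"
  proof (rule bucketed_run_correct[OF runs outputs D' M_E _ ms(1) ms_sub instance_graph_words[OF inst B] len])
    show "best_matching dec (encode c (concat (map (\<lambda>g. concat (map (D' g) [0..<q])) [0..<G]))) = encode c ms"
      using ms(3) by (simp add: all_def)
    show "S n m V \<epsilon> \<le> S'" by (simp add: S')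
    show "3 \<le> S'" if "E \<noteq> {}" using lower(2)[OF that] by (simp add: S')
    \<comment> \<open>A nonempty graph has a vertex, so \<open>G\<close> is at most
      \<open>n * G\<close>.\<close>
    show "3 * G \<le> S'" if "E \<noteq> {}" using n_pos[OF that] by (simp add: S' trans_le_add2)
    show "3 * (\<Sum>g<G. card (M g)) \<le> S'" using sum_card by (simp add: S')
    show "3 * card E \<le> h" using lower(1) by (simp add: h(1))
  qed
  have NP: "N = P" by (simp add: N sel_def K_def \<Lambda>_def r_def NA_def)
  define D'' where "D'' j = (if j = 0 then ms else [])" for j :: nat
  have "concat (map D'' [0..<G * q]) = ms"
  \<comment> \<open>Without machines there is no machine 0 to hold \<open>ms\<close>; but then no
    group has any output either, and \<open>ms\<close> is empty.\<close>
  proof (cases "q = 0")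
    case True
    then have "set all = {}" by (simp add: all_def)
    then show ?thesis using ms_sub True by (simp add: set_all)
  next
    case False
    then show ?thesis
      using Gpos concat_map_single[of 0 "\<lambda>_. ms" "G * q"] by (simp add: D''_def[abs_def])
  qed
  then have "distributed (machines P) D'' (set ms)"
    using ms(1) by (simp add: distributed_def)
  moreover have "memory P x (r + 4) i = encode c (D'' i)" if "i < machines P" for i
    using run that unfolding machines_P D''_def by (cases "i = 0") (simp_all del: memory.simps)
  moreover have "approx_max_weight_matching (1 + 16 * \<epsilon>) E (dec \<circ> c) (set ms)"
    using E(2) approx ms(2) unfolding Eg_def sel_def set_all G
    by (intro grouped_matchings_approx[OF \<epsilon>(1,2) K(2) \<Lambda> E(1), of _ M]) auto
  ultimately show ?thesis using run unfolding NP r_def[symmetric] by blast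
qed

lemma reduction_run:
  assumes W: "valid_params W \<epsilon>" and B: "n \<le> B" and inst: "instance_graph dec n m W B E c"
    and D: "distributed p D E"
    and len: "\<And>i. i < p \<Longrightarrow> length (encode c (D i)) \<le> reduction_space n m W \<epsilon>"
    and N: "N = reduction n m W \<epsilon> B p"
  shows "space_bounded B N (initial_memory p c D) (reduction_rounds n m W \<epsilon>)
      (reduction_space n m W \<epsilon>) (reduction_total n m W \<epsilon>) \<and>
    (\<exists>D' M. distributed (machines N) D' M \<and>
      (\<forall>i<machines N. memory N (initial_memory p c D) (reduction_rounds n m W \<epsilon>) i = encode c (D' i)) \<and>
      approx_max_weight_matching (1 + 16 * \<epsilon>) E (dec \<circ> c) M)"
proof -
  define V where "V = group_ratio \<epsilon>"
  have V: "valid_params V \<epsilon>" using valid_group_ratio[OF W] by (simp add: V_def)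
  have E: "simple_graph n E" "\<And>e. e \<in> E \<Longrightarrow> 0 < dec (c e)"
    using inst by (auto simp: instance_graph_def)
  have fin: "finite E" using E(1) by (rule simple_graph_finite)
  have \<epsilon>: "0 < \<epsilon>" using W by (simp add: valid_params_def)
  have nonneg: "0 \<le> sum (dec \<circ> c) M" if "M \<subseteq> E" for M
    using that E(2) by (intro sum_nonneg) (auto intro: less_imp_le)
  note lower = mpc_mwm_algorithm_lower_bounds[OF A V B inst]
  consider "W \<le> V" | "\<not> W \<le> V" "trivial_params n m \<epsilon>" | "\<not> W \<le> V" "\<not> trivial_params n m \<epsilon>"
    by blast
  then show ?thesis
  proof cases
    case 1
    have defs: "N = A n m V \<epsilon> B p" "reduction_rounds n m W \<epsilon> = R n m V \<epsilon>"
      "reduction_space n m W \<epsilon> = S n m V \<epsilon>" "reduction_total n m W \<epsilon> = T n m V \<epsilon>"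
      using 1 by (simp_all add: N V_def reduction_def reduction_rounds_def reduction_space_def
          reduction_total_def Let_def)
    have inst': "instance_graph dec n m V B E c"
      using inst 1 unfolding instance_graph_def by (meson order_trans)
    note run = mpc_mwm_algorithm_run(2)[OF A V B inst' D len[unfolded defs]]
    \<comment> \<open>The factor may be enlarged because matchings have nonnegative weight.\<close>
    have "approx_max_weight_matching (1 + 16 * \<epsilon>) E (dec \<circ> c) M"
      if M: "approx_max_weight_matching (1 + \<epsilon>) E (dec \<circ> c) M" for M
    proof -
      have "M \<subseteq> E" using M by (simp add: approx_max_weight_matching_def is_matching_def)
      then have "(1 + \<epsilon>) * sum (dec \<circ> c) M \<le> (1 + 16 * \<epsilon>) * sum (dec \<circ> c) M"
        using nonneg \<epsilon> by (intro mult_right_mono) auto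
      then show ?thesis using M unfolding approx_max_weight_matching_iff[OF fin] by (meson order_trans)
    qed
    then show ?thesis using run unfolding defs by meson
  next
    case 2
    have defs: "machines N = p" "reduction_rounds n m W \<epsilon> = 0"
      "reduction_space n m W \<epsilon> = S n m V \<epsilon>" "reduction_total n m W \<epsilon> = T n m V \<epsilon>"
      using 2 by (simp_all add: N V_def reduction_def reduction_rounds_def reduction_space_def
          reduction_total_def Let_def)
    have mem: "memory N (initial_memory p c D) 0 i = encode c (D i)" if "i < p" for i
      using that by (simp add: initial_memory_def)
    have sub: "set (D i) \<subseteq> E" if "i < p" for i
      using D that by (auto simp: distributed_def)
    have "(\<Sum>i<p. length (encode c (D i))) = 3 * card E"
      using D unfolding length_encode sum_distrib_left[symmetric] sum_length_concat
      by (auto simp: distributed_def distinct_card[symmetric])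
    then have "space_bounded B N (initial_memory p c D) 0 (S n m V \<epsilon>) (T n m V \<epsilon>)"
      using lower(1) len[unfolded defs] instance_graph_words[OF inst B] sub
      unfolding space_bounded_def defs by (auto simp: initial_memory_def set_encode subset_iff)
    \<comment> \<open>Zero rounds force the input to be a matching, zero total space forces it to be
      empty. Either way the input, left in place, is an optimal output.\<close>
    moreover have "is_matching E E"
    proof (cases "R n m V \<epsilon> = 0")
      case False
      then have "card E = 0" using 2(2) lower(1) by (simp add: trivial_params_def V_def)
      then show ?thesis using fin by (simp add: is_matching_def)
    qed (rule lower(3))
    then have "approx_max_weight_matching (1 + 16 * \<epsilon>) E (dec \<circ> c) E"
      unfolding approx_max_weight_matching_iff[OF fin]
    proof (intro conjI allI impI)
      fix M assume "is_matching E M"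
      then have "M \<subseteq> E" by (simp add: is_matching_def)
      then have "sum (dec \<circ> c) M \<le> 1 * sum (dec \<circ> c) E"
        unfolding mult_1 using fin E(2) by (intro sum_mono2) (auto intro: less_imp_le)
      also have "\<dots> \<le> (1 + 16 * \<epsilon>) * sum (dec \<circ> c) E"
        using \<epsilon> nonneg by (intro mult_right_mono) auto
      finally show "sum (dec \<circ> c) M \<le> (1 + 16 * \<epsilon>) * sum (dec \<circ> c) E" .
    qed
    ultimately show ?thesis using D mem unfolding defs by blast
  next
    case 3
    have defs: "reduction_rounds n m W \<epsilon> = R n m V \<epsilon> + 4"
      "reduction_space n m W \<epsilon> = S n m V \<epsilon> + 3 * (n * group_count \<epsilon> W)"
      "reduction_total n m W \<epsilon> = group_count \<epsilon> W * T n m V \<epsilon>"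
      "N = bucketed_network (\<lambda>g a. in_group \<epsilon> (shift_count \<epsilon>) (level_count \<epsilon> W) g (dec a))
       (best_matching dec) (group_count \<epsilon> W) (T n m V \<epsilon>) (R n m V \<epsilon>)
       (A n m V \<epsilon> B (p * T n m V \<epsilon>))"
      using 3 by (simp_all add: N V_def reduction_def reduction_rounds_def reduction_space_def
          reduction_total_def Let_def)
    have "0 < T n m V \<epsilon>" using 3(2) by (simp add: trivial_params_def V_def)
    from reduction_run_bucketed[OF W B inst refl this[unfolded V_def] refl D]
    show ?thesis using len unfolding defs V_def by blast
  qed
qed

lemma reduction_correct:
  "mpc_mwm_algorithm dec (\<lambda>\<epsilon>. 1 + 16 * \<epsilon>) reduction reduction_rounds reduction_space reduction_total"
  unfolding mpc_mwm_algorithm_def[of _ _ reduction] Let_def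
proof (intro conjI reduction_machines allI impI)
  fix n m W \<epsilon> B E c
  assume W: "valid_params W \<epsilon>" and B: "n \<le> B" and inst: "instance_graph dec n m W B E c"
  show "3 \<le> reduction_space n m W \<epsilon>" if "E \<noteq> {}"
    using mpc_mwm_algorithm_lower_bounds(2)[OF A valid_group_ratio[OF W] B inst that]
    by (simp add: reduction_space_def Let_def)
  fix p D
  assume "distributed p D E" "\<forall>i<p. length (encode c (D i)) \<le> reduction_space n m W \<epsilon>"
  with reduction_run[OF W B inst _ _ refl]
  show "space_bounded B (reduction n m W \<epsilon> B p) (initial_memory p c D) (reduction_rounds n m W \<epsilon>)
      (reduction_space n m W \<epsilon>) (reduction_total n m W \<epsilon>)"
    "\<exists>D' M. distributed (machines (reduction n m W \<epsilon> B p)) D' M \<and>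
      (\<forall>i<machines (reduction n m W \<epsilon> B p). memory (reduction n m W \<epsilon> B p) (initial_memory p c D)
        (reduction_rounds n m W \<epsilon>) i = encode c (D' i)) \<and>
      approx_max_weight_matching (1 + 16 * \<epsilon>) E (dec \<circ> c) M"
    by blast+
qed

end

end

theorem theorem14:
  "\<exists>(f :: real \<Rightarrow> real) (C :: real).
     \<forall>(dec :: nat \<Rightarrow> real) (A :: mpc_algorithm) (R :: resource) (S :: resource) (T :: resource).
       mpc_mwm_algorithm dec (\<lambda>\<epsilon>. 1 + \<epsilon>) A R S T \<longrightarrow>
       (\<exists>(A' :: mpc_algorithm) (R' :: resource) (S' :: resource) (T' :: resource).
          mpc_mwm_algorithm dec (\<lambda>\<epsilon>. 1 + 16 * \<epsilon>) A' R' S' T' \<and>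
          (\<forall>n m W \<epsilon>. valid_params W \<epsilon> \<longrightarrow>
             real (R' n m W \<epsilon>) \<le> C * real (R n m (f \<epsilon>) \<epsilon>) \<and>
             real (S' n m W \<epsilon>) \<le>
               C * (real (S n m (f \<epsilon>) \<epsilon>) + real n * log (1 / \<epsilon>) (max 2 W)) \<and>
             real (T' n m W \<epsilon>) \<le>
               C * (real (T n m (f \<epsilon>) \<epsilon>) * log (1 / \<epsilon>) (max 2 W) / \<epsilon>)))"
\<comment> \<open>Both witnesses are fixed before the number format, the algorithm and its
  resources: the ratio depends on \<epsilon> alone, and 12 is absolute.\<close>
proof (rule exI[of _ group_ratio], rule exI[of _ 12], intro allI impI)
  fix dec :: "nat \<Rightarrow> real" and A R S T
  assume A: "mpc_mwm_algorithm dec (\<lambda>\<epsilon>. 1 + \<epsilon>) A R S T"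
  show "\<exists>A' R' S' T'.
          mpc_mwm_algorithm dec (\<lambda>\<epsilon>. 1 + 16 * \<epsilon>) A' R' S' T' \<and>
          (\<forall>n m W \<epsilon>. valid_params W \<epsilon> \<longrightarrow>
             real (R' n m W \<epsilon>) \<le> 12 * real (R n m (group_ratio \<epsilon>) \<epsilon>) \<and>
             real (S' n m W \<epsilon>) \<le>
               12 * (real (S n m (group_ratio \<epsilon>) \<epsilon>) + real n * log (1 / \<epsilon>) (max 2 W)) \<and>
             real (T' n m W \<epsilon>) \<le>
               12 * (real (T n m (group_ratio \<epsilon>) \<epsilon>) * log (1 / \<epsilon>) (max 2 W) / \<epsilon>))"
  proof (intro exI conjI allI impI)
    show "mpc_mwm_algorithm dec (\<lambda>\<epsilon>. 1 + 16 * \<epsilon>) (reduction dec A R T)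
        (reduction_rounds R T) (reduction_space R S T) (reduction_total R T)"
      by (rule reduction_correct[OF A])
  qed (erule reduction_bounds)+
qed

end
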